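(* Let $d>1$ and let $\mathscr{B}_0,\dots,\mathscr{B}_{m-1}\subset\operatorname{PU}(d)$, where each $\mathscr{B}_a=\{e^a_j\}_{j=0}^{d^2-1}$ is such that $\{U(e^a_j)\}_{j=0}^{d^2-1}$ is a unitary operator basis for $\operatorname{End}(\mathbb{C}^d)$. Suppose there are basis weights $w_0,\dots,w_{m-1}>0$ such that the union $\mathscr{D}=\bigcup_a\mathscr{B}_a$, with weight function $w(x)=\sum_{a}w_a\,1_{\mathscr{B}_a}(x)$, forms a weighted unitary $2$-design. Then $m\ge d^2-1$, and if $m=d^2-1$ then $w_a=1/(md^2)$ for all $a$ and the bases are pairwise mutually unbiased.
   Context: $\operatorname{PU}(d)=\operatorname{U}(d)/\operatorname{U}(1)$, $U(x)$ a representative of $x$, $\mu$ the Haar probability measure. A unitary operator basis is $\{U_j\}_{j=0}^{d^2-1}\subset\operatorname{U}(d)$ with $\operatorname{tr}(U_j^\dagger U_k)=d\delta_{jk}$; two such bases $\{U_j\},\{V_k\}$ are mutually unbiased if $|\operatorname{tr}(U_j^\dagger V_k)|^2=1$ for all $j,k$. $1_{\mathscr{B}}$ denotes the indicator function of $\mathscr{B}$. A weighted unitary $2$-design is a finite $\mathscr{D}\subset\operatorname{PU}(d)$ with weights $w:\mathscr{D}\to(0,1]$, $\sum w=1$, and $\sum_{x\in\mathscr{D}}w(x)U(x)^{\otimes2}\otimes(U(x)^{\otimes2})^\dagger=\int_{\operatorname{PU}(d)}d\mu(x)U(x)^{\otimes2}\otimes(U(x)^{\otimes2})^\dagger$. 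*)

theory Defs
  imports "HOL-Probability.Probability"
begin

type_synonym 'n cmat = "complex^'n^'n"

definition cadj :: "'n::finite cmat \<Rightarrow> 'n cmat" where
  "cadj A = (\<chi> i j. cnj (A $ j $ i))"

definition unitary :: "'n::finite cmat \<Rightarrow> bool" where
  "unitary U \<longleftrightarrow> cadj U ** U = mat 1"

definition ctrace :: "'n::finite cmat \<Rightarrow> complex" where
  "ctrace A = (\<Sum>i\<in>UNIV. A $ i $ i)"

definition pclass :: "'n::finite cmat \<Rightarrow> 'n cmat set" where
  "pclass U = {(\<chi> i j. c * U $ i $ j) | c::complex. cmod c = 1}"

definition PU :: "'n::finite cmat set set" where
  "PU = pclass ` {U. unitary U}"

definition rep :: "'n::finite cmat set \<Rightarrow> 'n cmat" where
  "rep x = (SOME U. U \<in> x)"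

definition unitary_operator_basis :: "(nat \<Rightarrow> 'n::finite cmat) \<Rightarrow> bool" where
  "unitary_operator_basis U \<longleftrightarrow>
     (\<forall>j < CARD('n)^2. unitary (U j)) \<and>
     (\<forall>j < CARD('n)^2. \<forall>k < CARD('n)^2.
        ctrace (cadj (U j) ** U k) = (if j = k then of_nat CARD('n) else 0))"

definition mutually_unbiased :: "(nat \<Rightarrow> 'n::finite cmat) \<Rightarrow> (nat \<Rightarrow> 'n cmat) \<Rightarrow> bool" where
  "mutually_unbiased U V \<longleftrightarrow>
     (\<forall>j < CARD('n)^2. \<forall>k < CARD('n)^2. (cmod (ctrace (cadj (U j) ** V k)))^2 = 1)"

text \<open>Entries of U^{\<otimes>2} \<otimes> (U^{\<otimes>2})^\<dagger>, as a function of row indices (i1,i2,i3,i4)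
  and column indices (j1,j2,j3,j4).\<close>
definition tens22 :: "'n::finite cmat \<Rightarrow> 'n \<times> 'n \<times> 'n \<times> 'n \<Rightarrow> 'n \<times> 'n \<times> 'n \<times> 'n \<Rightarrow> complex" where
  "tens22 U = (\<lambda>(i1,i2,i3,i4) (j1,j2,j3,j4).
      U $ i1 $ j1 * U $ i2 $ j2 * cadj U $ i3 $ j3 * cadj U $ i4 $ j4)"

text \<open>Haar probability measure on U(d): a probability measure on the Borel sets of
  matrices, concentrated on U(d), invariant under left multiplication by unitaries.
  (Its pushforward to PU(d) is the Haar probability measure on PU(d).)\<close>
definition haar_unitary :: "'n::finite cmat measure \<Rightarrow> bool" where
  "haar_unitary \<mu> \<longleftrightarrow> prob_space \<mu> \<and> sets \<mu> = sets borel \<and>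
     (AE U in \<mu>. unitary U) \<and>
     (\<forall>V. unitary V \<longrightarrow> distr \<mu> borel (\<lambda>U. V ** U) = \<mu>)"

definition weighted_2_design :: "'n::finite cmat set set \<Rightarrow> ('n cmat set \<Rightarrow> real) \<Rightarrow> bool" where
  "weighted_2_design D w \<longleftrightarrow> finite D \<and> D \<subseteq> PU \<and>
     (\<forall>x\<in>D. 0 < w x \<and> w x \<le> 1) \<and> (\<Sum>x\<in>D. w x) = 1 \<and>
     (\<forall>\<mu>. haar_unitary \<mu> \<longrightarrow>
        (\<forall>I J. (\<Sum>x\<in>D. of_real (w x) * tens22 (rep x) I J) =
               (\<integral>U. tens22 U I J \<partial>\<mu>)))"

end

theory Submission
  imports Defs
begin

text \<open>
  Fix an element \<open>y\<close> of the basis \<open>B\<^sub>b\<close>. Since the design integrates the polynomial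
  \<open>\<bar>tr (y\<^sup>\<dagger>U)\<bar>\<^sup>4\<close> exactly, and its Haar integral equals 2, we get
  \<open>\<Sum>\<^sub>a w\<^sub>a \<Sum>\<^sub>j \<bar>tr (y\<^sup>\<dagger>e\<^sup>a\<^sub>j)\<bar>\<^sup>4 = 2\<close>. The term \<open>a = b\<close> contributes \<open>w\<^sub>b d\<^sup>4\<close>; for
  \<open>a \<noteq> b\<close> the numbers \<open>\<bar>tr (y\<^sup>\<dagger>e\<^sup>a\<^sub>j)\<bar>\<^sup>2\<close> have mean 1 by Parseval, so their squares sum to at least
  \<open>d\<^sup>2\<close>, with equality iff they are all 1. As the total weight is 1, this gives
  \<open>w\<^sub>b d\<^sup>2 (d\<^sup>2 - 1) \<le> 1\<close>, and summing over \<open>b\<close> gives \<open>m \<ge> d\<^sup>2 - 1\<close>; the equality case follows.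

  The design condition speaks about every Haar measure, so one has to be exhibited: it is the image
  of the uniform measure on the invertible matrices in the unit ball under Gram-Schmidt. The
  moment \<open>\<integral>\<bar>tr U\<bar>\<^sup>4\<close> then follows from left invariance under diagonal phases, row swaps and
  rotations in two rows, together with orthonormality of the columns.
\<close>

subsection \<open>Isometry invariance of Lebesgue measure\<close>

lemma nn_integral_lborel_shift:
  fixes f :: "'a::euclidean_space \<Rightarrow> ennreal"
  assumes [measurable]: "f \<in> borel_measurable borel"
  shows "(\<integral>\<^sup>+x. f (x + c) \<partial>lborel) = (\<integral>\<^sup>+x. f x \<partial>lborel)"
proof -
  have "(\<integral>\<^sup>+x. f x \<partial>lborel) = (\<integral>\<^sup>+x. f x \<partial>(distr lborel borel ((+) c)))"
    by (simp add: lborel_distr_plus)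
  also have "\<dots> = (\<integral>\<^sup>+x. f (x + c) \<partial>lborel)"
    by (subst nn_integral_distr) (auto simp: add.commute)
  finally show ?thesis by simp
qed

text \<open>Weil's uniqueness argument: comparing the image measure with \<^term>\<open>lborel\<close> on products of
  a test set with the unit ball, which the isometry preserves, avoids determinants.\<close>
lemma lborel_distr_isometry:
  fixes T :: "'a::euclidean_space \<Rightarrow> 'a"
  assumes lin: "linear T" and iso: "\<And>x. norm (T x) = norm x"
  shows "distr lborel borel T = lborel"
proof (rule measure_eqI)
  have cont: "continuous_on UNIV T"
    using lin by (simp add: linear_continuous_on linear_conv_bounded_linear)
  have [measurable]: "T \<in> borel_measurable borel"
    by (rule borel_measurable_continuous_onI[OF cont])
  have inj: "inj T"
    using iso lin by (metis linear_injective_0 norm_eq_zero)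
  have surj: "surj T" using linear_injective_imp_surjective[OF lin inj] by simp
  define B where "B = ball (0::'a) 1"
  have [measurable]: "B \<in> sets borel" by (simp add: B_def)
  have Bfin: "emeasure lborel B < \<infinity>"
    unfolding B_def by (rule emeasure_bounded_finite) simp
  \<comment> \<open>Finite and nonzero volume of the ball allows it to be cancelled at the
    end.\<close>
  have Bpos: "emeasure lborel B \<noteq> 0"
  proof
    assume "emeasure lborel B = 0"
    then have "negligible B"
      by (simp add: negligible_iff_null_sets null_sets_def B_def)
    moreover have "open B" "B \<noteq> {}" by (auto simp: B_def)
    ultimately show False using open_not_negligible by blast
  qed
  have B: "indicator B (- x) = (indicator B x :: ennreal)" "indicator B (T x) = (indicator B x :: ennreal)" for x
    by (auto simp: B_def indicator_def iso)
  show "sets (distr lborel borel T) = sets lborel" by simp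
  fix A assume "A \<in> sets (distr lborel borel T)"
  then have [measurable]: "A \<in> sets borel" by simp
  let ?I = "\<lambda>X x. indicator X x :: ennreal"
  have "emeasure (distr lborel borel T) A * emeasure lborel B
      = (\<integral>\<^sup>+x. ?I A (T x) \<partial>lborel) * (\<integral>\<^sup>+y. ?I B y \<partial>lborel)"
    by (subst nn_integral_distr[of T lborel borel "?I A", symmetric]) simp_all
  also have "\<dots> = (\<integral>\<^sup>+x. ?I A (T x) * (\<integral>\<^sup>+y. ?I B y \<partial>lborel) \<partial>lborel)"
    by (subst nn_integral_multc) auto
  \<comment> \<open>Translating the ball by \<open>T x\<close> does not change its volume; the
    resulting double integral can be taken in either order.\<close>
  also have "\<dots> = (\<integral>\<^sup>+x. ?I A (T x) * (\<integral>\<^sup>+y. ?I B (y + - T x) \<partial>lborel) \<partial>lborel)"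
    by (subst nn_integral_lborel_shift) auto
  also have "\<dots> = (\<integral>\<^sup>+x. (\<integral>\<^sup>+y. ?I A (T x) * ?I B (y - T x) \<partial>lborel) \<partial>lborel)"
    by (subst nn_integral_cmult[symmetric]) auto
  also have "\<dots> = (\<integral>\<^sup>+y. (\<integral>\<^sup>+x. ?I A (T x) * ?I B (y - T x) \<partial>lborel) \<partial>lborel)"
    by (rule lborel_pair.Fubini') measurable
  also have "\<dots> = (\<integral>\<^sup>+y. (\<integral>\<^sup>+x. ?I A (T x + y) * ?I B x \<partial>lborel) \<partial>lborel)"
  proof (rule nn_integral_cong)
    fix y
    \<comment> \<open>Substituting \<open>x + c\<close> turns \<open>y - T (x + c)\<close> into
      \<open>- T x\<close>. The ball is stable under sign change and under \<open>T\<close>, so this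
      factor becomes \<open>?I B x\<close>.\<close>
    obtain c where c: "T c = y" using surj by (metis surjD)
    have "(\<integral>\<^sup>+x. ?I A (T x) * ?I B (y - T x) \<partial>lborel)
        = (\<integral>\<^sup>+x. ?I A (T (x + c)) * ?I B (y - T (x + c)) \<partial>lborel)"
      by (subst nn_integral_lborel_shift[symmetric, where c=c]) auto
    also have "\<dots> = (\<integral>\<^sup>+x. ?I A (T x + y) * ?I B x \<partial>lborel)"
      by (simp add: linear_add[OF lin] c B)
    finally show "(\<integral>\<^sup>+x. ?I A (T x) * ?I B (y - T x) \<partial>lborel)
        = (\<integral>\<^sup>+x. ?I A (T x + y) * ?I B x \<partial>lborel)" .
  qed
  also have "\<dots> = (\<integral>\<^sup>+x. (\<integral>\<^sup>+y. ?I A (T x + y) * ?I B x \<partial>lborel) \<partial>lborel)"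
    by (rule lborel_pair.Fubini'[symmetric]) measurable
  also have "\<dots> = (\<integral>\<^sup>+x. (\<integral>\<^sup>+y. ?I A (y + T x) \<partial>lborel) * ?I B x \<partial>lborel)"
    by (subst nn_integral_multc[symmetric]) (auto simp: add.commute)
  also have "\<dots> = (\<integral>\<^sup>+x. (\<integral>\<^sup>+y. ?I A y \<partial>lborel) * ?I B x \<partial>lborel)"
    by (subst nn_integral_lborel_shift) auto
  also have "\<dots> = emeasure lborel A * emeasure lborel B"
    by (subst nn_integral_cmult) auto
  finally show "emeasure (distr lborel borel T) A = emeasure lborel A"
    using Bfin Bpos ennreal_mult_cancel_left[of "emeasure lborel B"]
    by (auto simp: mult.commute[of _ "emeasure lborel B"])
qed

section \<open>Unitary matrices and the Frobenius norm\<close>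

lemma cadj_matrix_mul: "cadj (A ** B) = cadj B ** cadj A"
  by (simp add: cadj_def matrix_matrix_mult_def vec_eq_iff mult.commute)

lemma unitary_right: "unitary U \<Longrightarrow> U ** cadj U = mat 1"
  unfolding unitary_def using matrix_left_right_inverse by blast

lemma unitary_columns:
  assumes "unitary U"
  shows "(\<Sum>r\<in>UNIV. U $ r $ i * cnj (U $ r $ j)) = (if i = j then 1 else 0)"
proof -
  have "(cadj U ** U) $ j $ i = (if i = j then 1 else 0)"
    using assms by (simp add: unitary_def mat_def)
  then show ?thesis by (simp add: cadj_def matrix_matrix_mult_def mult.commute)
qed

text \<open>The norm of a nested vector is the Frobenius norm. In this form its invariance under
  \<open>V\<close> reduces to \<open>cadj V ** V = mat 1\<close>.\<close>

lemma norm_sq_matrix: "complex_of_real ((norm A)\<^sup>2) = ctrace (cadj A ** A)"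
proof -
  have "(norm A)\<^sup>2 = (\<Sum>i\<in>UNIV. \<Sum>j\<in>UNIV. (cmod (A $ i $ j))\<^sup>2)"
    by (simp add: norm_vec_def L2_set_def sum_nonneg real_sqrt_pow2)
  also have "\<dots> = (\<Sum>j\<in>UNIV. \<Sum>i\<in>UNIV. (cmod (A $ i $ j))\<^sup>2)"
    by (rule sum.swap)
  finally show ?thesis
    by (simp add: ctrace_def cadj_def matrix_matrix_mult_def complex_norm_square mult.commute
        del: of_real_power)
qed

lemma norm_unitary_mul:
  fixes A :: "'n::finite cmat"
  assumes "unitary V" shows "norm (V ** A) = norm A"
proof -
  have "cadj (V ** A) ** (V ** A) = cadj A ** A"
    using assms unfolding unitary_def cadj_matrix_mul
    by (metis matrix_mul_assoc matrix_mul_lid)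
  then have "complex_of_real ((norm (V ** A))\<^sup>2) = complex_of_real ((norm A)\<^sup>2)"
    by (simp only: norm_sq_matrix)
  then show ?thesis by (simp only: of_real_eq_iff power2_eq_iff_nonneg norm_ge_zero)
qed

lemma linear_matrix_mul: "linear (\<lambda>A::'n::finite cmat. V ** A)"
  by (rule linearI)
     (simp_all add: matrix_matrix_mult_def vec_eq_iff sum.distrib algebra_simps scaleR_sum_right)

lemma matrix_mul_borel [measurable]: "(\<lambda>A::'n::finite cmat. V ** A) \<in> borel_measurable borel"
  using linear_matrix_mul[of V]
  by (intro borel_measurable_continuous_onI linear_continuous_on) (simp add: linear_conv_bounded_linear)

text \<open>Left multiplication by a unitary is a real-linear isometry of the whole matrix
  space.\<close>

lemma lborel_distr_unitary:
  "unitary V \<Longrightarrow> distr lborel borel (\<lambda>A::'n::finite cmat. V ** A) = lborel"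
  by (intro lborel_distr_isometry linear_matrix_mul norm_unitary_mul)

subsection \<open>Gram-Schmidt orthonormalisation and the existence of Haar measure\<close>

text \<open>Conjugate-linear in the first argument; its real part is the \<open>inner\<close> of
  this type.\<close>

definition cinner :: "complex^'n::finite \<Rightarrow> complex^'n \<Rightarrow> complex" where
  "cinner x y = (\<Sum>i\<in>UNIV. cnj (x $ i) * y $ i)"

lemma cinner_diff_right: "cinner x (y - z) = cinner x y - cinner x z"
  by (simp add: cinner_def algebra_simps sum_subtractf)

lemma cinner_smult_right: "cinner x (c *s y) = c * cinner x y"
  by (simp add: cinner_def sum_distrib_left algebra_simps)

lemma cinner_smult_left: "cinner (c *s x) y = cnj c * cinner x y"
  by (simp add: cinner_def sum_distrib_left algebra_simps)

lemma cinner_sum_right: "cinner x (\<Sum>k\<in>K. f k) = (\<Sum>k\<in>K. cinner x (f k))"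
  unfolding cinner_def sum_component by (simp add: sum_distrib_left) (rule sum.swap)

lemma cinner_cnj: "cnj (cinner x y) = cinner y x"
  by (simp add: cinner_def mult.commute)

lemma cinner_self: "cinner x x = complex_of_real ((norm x)\<^sup>2)"
  by (simp add: cinner_def norm_vec_def L2_set_def sum_nonneg real_sqrt_pow2 complex_norm_square mult.commute
      del: of_real_power)

lemma cinner_unitary:
  assumes "unitary V" shows "cinner (V *v x) (V *v y) = cinner x y"
proof -
  have "cinner (V *v x) (V *v y)
      = (\<Sum>i\<in>UNIV. (\<Sum>j\<in>UNIV. cnj (V $ i $ j) * cnj (x $ j)) * (\<Sum>k\<in>UNIV. V $ i $ k * y $ k))"
    by (simp add: cinner_def matrix_vector_mult_def)
  also have "\<dots> = (\<Sum>j\<in>UNIV. \<Sum>k\<in>UNIV. \<Sum>i\<in>UNIV. cnj (x $ j) * y $ k * (V $ i $ k * cnj (V $ i $ j)))"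
    unfolding sum_product
    by (subst sum.swap, rule sum.cong[OF refl], subst sum.swap) (simp add: mult_ac)
  also have "\<dots> = cinner x y"
    by (simp add: sum_distrib_left[symmetric] unitary_columns[OF assms] cinner_def if_distrib cong: if_cong)
  finally show ?thesis .
qed

lemma norm_unitary_mulv: assumes "unitary V" shows "norm (V *v x) = norm x"
proof -
  have "complex_of_real ((norm (V *v x))\<^sup>2) = complex_of_real ((norm x)\<^sup>2)"
    using cinner_unitary[OF assms, of x x] by (simp only: cinner_self)
  then show ?thesis by (simp only: of_real_eq_iff power2_eq_iff_nonneg norm_ge_zero)
qed

text \<open>If the residue vanishes, \<open>1 / 0 = 0\<close> makes the output the zero vector. This
  does not happen for the columns of an invertible matrix, and only such matrices carry the measure
  constructed below.\<close>

function gram_schmidt :: "(nat \<Rightarrow> complex^'n::finite) \<Rightarrow> nat \<Rightarrow> complex^'n" where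
  "gram_schmidt a k =
     (let r = a k - (\<Sum>j<k. cinner (gram_schmidt a j) (a k) *s gram_schmidt a j)
      in complex_of_real (1 / norm r) *s r)"
  by pat_completeness auto
termination by (relation "Wellfounded.measure snd") auto

declare gram_schmidt.simps [simp del]

definition gs_residue :: "(nat \<Rightarrow> complex^'n::finite) \<Rightarrow> nat \<Rightarrow> complex^'n" where
  "gs_residue a k = a k - (\<Sum>j<k. cinner (gram_schmidt a j) (a k) *s gram_schmidt a j)"

lemma gram_schmidt_residue:
  "gram_schmidt a k = complex_of_real (1 / norm (gs_residue a k)) *s gs_residue a k"
  by (subst gram_schmidt.simps) (simp add: gs_residue_def Let_def)

lemma mulv_sum: "V *v (\<Sum>k\<in>K. f k) = (\<Sum>k\<in>K. V *v (f k :: complex^'n::finite))"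
  by (induction K rule: infinite_finite_induct) (simp_all add: matrix_vector_right_distrib)

lemma mulv_smult: "V *v (c *s x) = c *s (V *v (x :: complex^'n::finite))"
  by (simp add: matrix_vector_mult_def vec_eq_iff sum_distrib_left algebra_simps)

text \<open>Inner products and norms are unchanged by \<open>V\<close>, so every residue is simply
  moved by \<open>V\<close>. This lets left invariance pass from Lebesgue measure to its image on
  the unitary group.\<close>

lemma gram_schmidt_unitary:
  assumes "unitary V"
  shows "gram_schmidt (\<lambda>k. V *v a k) k = V *v gram_schmidt a k"
proof (induction k rule: less_induct)
  case (less k)
  have "gs_residue (\<lambda>k. V *v a k) k = V *v gs_residue a k"
    unfolding gs_residue_def
    by (simp add: less cinner_unitary[OF assms] matrix_vector_mult_diff_distrib mulv_sum mulv_smult)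
  then show ?case
    by (simp add: gram_schmidt_residue norm_unitary_mulv[OF assms] mulv_smult)
qed

lemma gram_schmidt_orthonormal:
  assumes nz: "\<And>k. k < n \<Longrightarrow> gs_residue a k \<noteq> 0"
  shows "j < n \<Longrightarrow> k < n \<Longrightarrow>
    cinner (gram_schmidt a j) (gram_schmidt a k) = (if j = k then 1 else 0)"
proof -
  have self: "cinner (gram_schmidt a k) (gram_schmidt a k) = 1" if "k < n" for k
    using nz[OF that]
    unfolding gram_schmidt_residue cinner_smult_left cinner_smult_right unfolding cinner_self
    by (simp add: power2_eq_square)
  \<comment> \<open>Strong induction on the later index: among the vectors before \<open>k\<close>,
    orthonormality in either order follows from the induction hypothesis by conjugation, and then
    the projections cancel.\<close>
  have below: "\<forall>j<k. cinner (gram_schmidt a j) (gram_schmidt a k) = 0" if "k < n" for k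
    using that
  proof (induction k rule: less_induct)
    case (less k)
    have on: "cinner (gram_schmidt a j) (gram_schmidt a l) = (if l = j then 1 else 0)"
      if "j < k" "l < k" for j l
      using that less self[of j] less.IH[of l] less.IH[of j] cinner_cnj[of "gram_schmidt a l" "gram_schmidt a j"]
      by (cases j l rule: linorder_cases) auto
    show ?case
    proof (intro allI impI)
      fix j assume j: "j < k"
      have "cinner (gram_schmidt a j) (gs_residue a k) = 0"
        using j by (simp add: gs_residue_def cinner_diff_right cinner_sum_right cinner_smult_right on
            if_distrib cong: if_cong)
      then show "cinner (gram_schmidt a j) (gram_schmidt a k) = 0"
        by (simp add: gram_schmidt_residue[of a k] cinner_smult_right)
    qed
  qed
  show "j < n \<Longrightarrow> k < n \<Longrightarrow>
    cinner (gram_schmidt a j) (gram_schmidt a k) = (if j = k then 1 else 0)"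
    using self below cinner_cnj[of "gram_schmidt a k" "gram_schmidt a j"]
    by (cases j k rule: linorder_cases) auto
qed

text \<open>Gram-Schmidt is triangular: each residue is \<open>A\<close> applied to a unit vector
  minus a combination of earlier ones. That argument is nonzero, and \<open>A\<close> has trivial
  kernel.\<close>

lemma gs_residue_columns_nonzero:
  fixes A :: "'n::finite cmat" and h :: "nat \<Rightarrow> 'n"
  assumes inj: "\<And>x. A *v x = 0 \<Longrightarrow> x = 0" and h: "inj_on h {..<n}" and "k < n"
  shows "gs_residue (\<lambda>k. column (h k) A) k \<noteq> 0"
proof -
  let ?a = "\<lambda>k. column (h k) A"
  have col: "?a k = A *v axis (h k) 1" for k
    by (simp add: column_def matrix_vector_mult_def axis_def vec_eq_iff if_distrib cong: if_cong)
  \<comment> \<open>The vanishing of later coordinates is carried through the induction, because it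
    makes the subtracted vectors contribute 0 at coordinate \<open>h k\<close>, which therefore
    stays 1.\<close>
  have res: "\<exists>x. gs_residue ?a k = A *v x \<and> x $ h k = 1 \<and> (\<forall>l. k < l \<and> l < n \<longrightarrow> x $ h l = 0)"
    if "k < n" for k
    using that
  proof (induction k rule: less_induct)
    case (less k)
    then obtain X where X: "\<And>j. j < k \<Longrightarrow> gs_residue ?a j = A *v X j"
       "\<And>j l. j < k \<Longrightarrow> j < l \<Longrightarrow> l < n \<Longrightarrow> X j $ h l = 0"
      by (metis less_trans)
    define y where "y j = complex_of_real (1 / norm (gs_residue ?a j)) *s X j" for j
    have y: "gram_schmidt ?a j = A *v y j" if "j < k" for j
      using X(1)[OF that] by (simp add: gram_schmidt_residue y_def mulv_smult)
    have yh: "y j $ h l = 0" if "j < k" "j < l" "l < n" for j l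
      using X(2)[OF that] by (simp add: y_def)
    define x where "x = axis (h k) 1 - (\<Sum>j<k. cinner (gram_schmidt ?a j) (?a k) *s y j)"
    have "gs_residue ?a k = A *v x"
      by (simp add: gs_residue_def x_def col[symmetric] y matrix_vector_mult_diff_distrib mulv_sum mulv_smult)
    moreover have "x $ h k = 1"
      using less.prems by (simp add: x_def yh)
    moreover have "\<forall>l. k < l \<and> l < n \<longrightarrow> x $ h l = 0"
      using h less.prems by (auto simp: x_def yh axis_def inj_on_def)
    ultimately show ?case by blast
  qed
  then show ?thesis using inj[of _] assms(3)
    by (metis zero_index zero_neq_one)
qed

text \<open>The index type has no order, so \<open>h\<close> enumerates the columns;
  \<open>inv_into\<close> recovers the position at which column \<open>c\<close> is
  processed.\<close>

definition gs_matrix :: "(nat \<Rightarrow> 'n) \<Rightarrow> 'n::finite cmat \<Rightarrow> 'n cmat" where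
  "gs_matrix h A = (\<chi> i c. gram_schmidt (\<lambda>k. column (h k) A)
      (inv_into {..<CARD('n)} h c) $ i)"

lemma column_matrix_mul: "column c (V ** A) = V *v column c A"
  by (simp add: column_def matrix_matrix_mult_def matrix_vector_mult_def vec_eq_iff)

lemma gs_matrix_equivariant: "unitary V \<Longrightarrow> gs_matrix h (V ** A) = V ** gs_matrix h A"
  by (simp add: gs_matrix_def column_matrix_mul gram_schmidt_unitary vec_eq_iff)
     (simp add: matrix_matrix_mult_def matrix_vector_mult_def)

text \<open>A nonzero determinant gives a trivial kernel, hence nonzero residues, hence orthonormal
  columns.\<close>

lemma gs_matrix_unitary:
  fixes A :: "'n::finite cmat"
  assumes h: "bij_betw h {..<CARD('n)} (UNIV :: 'n set)" and det: "det A \<noteq> 0"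
  shows "unitary (gs_matrix h A)"
proof -
  have inj: "x = 0" if "A *v x = 0" for x
    using det that by (metis invertible_det_nz invertible_left_inverse matrix_left_invertible_ker)
  have hinj: "inj_on h {..<CARD('n)}" using h by (simp add: bij_betw_def)
  let ?g = "inv_into {..<CARD('n)} h"
  have g: "bij_betw ?g UNIV {..<CARD('n)}" using h by (rule bij_betw_inv_into)
  have g1: "?g c < CARD('n)" for c using bij_betwE[OF g] by auto
  have g2: "?g c = ?g d \<longleftrightarrow> c = d" for c d using g by (auto simp: bij_betw_def inj_on_def)
  have "(cadj (gs_matrix h A) ** gs_matrix h A) $ c $ d
      = cinner (gram_schmidt (\<lambda>k. column (h k) A) (?g c)) (gram_schmidt (\<lambda>k. column (h k) A) (?g d))" for c d
    by (simp add: gs_matrix_def cadj_def matrix_matrix_mult_def cinner_def)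
  also have "\<dots> c d = (if c = d then 1 else 0)" for c d
    using gram_schmidt_orthonormal[OF gs_residue_columns_nonzero[OF inj hinj] g1 g1] by (simp add: g2)
  finally show ?thesis by (simp add: unitary_def vec_eq_iff mat_def)
qed

section \<open>Measurability of Gram-Schmidt\<close>

lemma borel_measurable_vecI:
  fixes f :: "'a \<Rightarrow> ('b::euclidean_space)^'n::finite"
  assumes "\<And>i. (\<lambda>x. f x $ i) \<in> borel_measurable M"
  shows "f \<in> borel_measurable M"
proof (subst borel_measurable_euclidean_space, rule ballI)
  fix b :: "'b^'n" assume "b \<in> Basis"
  then obtain i u where b: "b = axis i u" by (auto simp: Basis_vec_def)
  show "(\<lambda>x. f x \<bullet> b) \<in> borel_measurable M"
    using assms[of i] by (simp add: b inner_axis)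
qed

lemma borel_measurable_nth:
  fixes f :: "'a \<Rightarrow> ('b::euclidean_space)^'n::finite"
  assumes "f \<in> borel_measurable M"
  shows "(\<lambda>x. f x $ i) \<in> borel_measurable M"
  by (rule measurable_compose[OF assms borel_measurable_continuous_onI]) (intro continuous_intros)

text \<open>Strong induction along the recursion. Division by the norm may be discontinuous where
  the residue vanishes, but it is still Borel.\<close>

lemma gram_schmidt_measurable:
  assumes a: "\<And>k. (\<lambda>A. a A k) \<in> borel_measurable M"
  shows "(\<lambda>A. gram_schmidt (a A) k) \<in> borel_measurable M"
proof (induction k rule: less_induct)
  case (less k)
  have 1: "(\<lambda>A. gram_schmidt (a A) j $ i) \<in> borel_measurable M" if "j < k" for i j
    using less[OF that] by (rule borel_measurable_nth)
  have 2: "(\<lambda>A. a A j $ i) \<in> borel_measurable M" for i j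
    using a by (rule borel_measurable_nth)
  have 3: "(\<lambda>A. cinner (gram_schmidt (a A) j) (a A k)) \<in> borel_measurable M" if "j < k" for j
    unfolding cinner_def using 1[OF that] 2
    by (intro borel_measurable_sum borel_measurable_times measurable_compose[OF _ borel_measurable_continuous_onI[of cnj]])
       (auto intro: continuous_intros)
  have r: "(\<lambda>A. gs_residue (a A) k) \<in> borel_measurable M"
    unfolding gs_residue_def
    by (rule borel_measurable_vecI) (use 1 2 3 in \<open>auto intro!: borel_measurable_sum borel_measurable_times borel_measurable_diff\<close>)
  show ?case unfolding gram_schmidt_residue
    using r borel_measurable_nth[OF r] by (intro borel_measurable_vecI) simp
qed

lemma gs_matrix_measurable [measurable]:
  fixes h :: "nat \<Rightarrow> 'n::finite"
  shows "gs_matrix h \<in> borel_measurable borel"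
proof -
  have col: "(\<lambda>A :: 'n cmat. column (h k) A) \<in> borel_measurable borel" for k
  proof (rule borel_measurable_vecI)
    fix i
    have "(\<lambda>A :: 'n cmat. A $ i $ h k) \<in> borel_measurable borel"
      by (intro borel_measurable_nth) simp
    then show "(\<lambda>A :: 'n cmat. column (h k) A $ i) \<in> borel_measurable borel"
      by (simp add: column_def)
  qed
  show ?thesis unfolding gs_matrix_def
    by (rule borel_measurable_vecI, rule borel_measurable_vecI)
       (simp, intro borel_measurable_nth gram_schmidt_measurable col)
qed

section \<open>Topology of the unitary group and its Haar measure\<close>

lemma continuous_on_det: "continuous_on UNIV (det :: 'n::finite cmat \<Rightarrow> complex)"
  unfolding det_def by (intro continuous_intros)

lemma det_unitary_nz: "unitary V \<Longrightarrow> det V \<noteq> 0"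
  unfolding unitary_def by (metis det_I det_mul mult_zero_right zero_neq_one)

lemma closed_unitary: "closed {U :: 'n::finite cmat. unitary U}"
proof -
  have "closed {U :: 'n cmat. cadj U ** U = mat 1}"
    unfolding cadj_def matrix_matrix_mult_def
    by (intro closed_Collect_eq continuous_intros)
  then show ?thesis by (simp add: unitary_def)
qed

text \<open>Every unitary has the Frobenius norm of the identity, so the closed set is
  bounded.\<close>

lemma compact_unitary: "compact {U :: 'n::finite cmat. unitary U}"
proof -
  have "norm U \<le> norm (mat 1 :: 'n cmat)" if "unitary U" for U :: "'n cmat"
    using norm_unitary_mul[OF that, of "mat 1"] by (simp add: matrix_mul_rid)
  then have "bounded {U :: 'n cmat. unitary U}" unfolding bounded_iff by blast
  then show ?thesis using closed_unitary by (simp add: compact_eq_bounded_closed)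
qed

lemma haar_unitary_exists: "\<exists>\<mu> :: 'n::finite cmat measure. haar_unitary \<mu>"
proof -
  obtain h where h: "bij_betw h {..<CARD('n)} (UNIV :: 'n set)"
    using ex_bij_betw_nat_finite[OF finite_class.finite_UNIV] by (auto simp: atLeast0LessThan)
  \<comment> \<open>This set is open and bounded, hence of positive finite volume once nonempty.
    Left multiplication by a unitary preserves the norm and the nonvanishing of the determinant,
    hence \<open>S\<close>.\<close>
  define S where "S = {A :: 'n cmat. norm A < 1 \<and> det A \<noteq> 0}"
  have op: "open S"
    unfolding S_def
    by (intro open_Collect_conj open_Collect_less open_Collect_neq continuous_on_det continuous_intros)
  have S_det: "det A \<noteq> 0" if "A \<in> S" for A using that by (simp add: S_def)
  have ne: "S \<noteq> {}"
  proof -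
    define N where "N = norm (mat 1 :: 'n cmat)"
    \<comment> \<open>Small enough that \<open>c * N < 1\<close>, which puts this multiple of the
      identity inside the ball.\<close>
    define c where "c = 1 / (2 * (1 + N))"
    have N: "N \<ge> 0" by (simp add: N_def)
    then have c: "c > 0" by (simp add: c_def)
    have "norm (c *\<^sub>R mat 1 :: 'n cmat) = c * N" using c by (simp add: N_def)
    also have "\<dots> < 1" using N by (simp add: c_def divide_simps)
    finally have "norm (c *\<^sub>R mat 1 :: 'n cmat) < 1" .
    moreover have "det (c *\<^sub>R mat 1 :: 'n cmat) \<noteq> 0"
    proof -
      have "(c *\<^sub>R mat 1 :: 'n cmat) ** ((1/c) *\<^sub>R mat 1) = mat 1"
        using c by (simp only: linear_scale[OF linear_matrix_mul] matrix_mul_rid) simp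
      then show ?thesis by (metis det_I det_mul mult_zero_left zero_neq_one)
    qed
    ultimately show ?thesis unfolding S_def by blast
  qed
  have [measurable]: "S \<in> sets borel" using op by simp
  have Sfin: "emeasure lborel S \<noteq> \<infinity>"
  proof -
    have "emeasure lborel S \<le> emeasure lborel (ball (0 :: 'n cmat) 1)"
      by (intro emeasure_mono) (auto simp: S_def)
    also have "\<dots> < \<infinity>" by (rule emeasure_bounded_finite) simp
    finally show ?thesis by simp
  qed
  have Spos: "emeasure lborel S \<noteq> 0"
  proof
    assume "emeasure lborel S = 0"
    then have "negligible S" by (simp add: negligible_iff_null_sets null_sets_def)
    then show False using op ne open_not_negligible by blast
  qed
  define \<nu> where "\<nu> = uniform_measure lborel S"
  have [measurable_cong]: "sets \<nu> = sets borel" by (simp add: \<nu>_def)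
  interpret \<nu>: prob_space \<nu>
    unfolding \<nu>_def using Spos Sfin by (rule prob_space_uniform_measure)
  \<comment> \<open>Left multiplication by \<open>V\<close> preserves both \<open>lborel\<close> and
    \<open>S\<close>, hence the normalised restriction.\<close>
  have inv: "distr \<nu> borel ((**) V) = \<nu>" if V: "unitary V" for V
  proof (rule measure_eqI)
    show "sets (distr \<nu> borel ((**) V)) = sets \<nu>" by (simp add: \<nu>_def)
    fix X assume "X \<in> sets (distr \<nu> borel ((**) V))"
    then have X[measurable]: "X \<in> sets borel" by simp
    have S: "V ** A \<in> S \<longleftrightarrow> A \<in> S" for A
      using V by (simp add: S_def norm_unitary_mul det_mul det_unitary_nz)
    have vim: "(**) V -` X \<in> sets borel"
      using measurable_sets[OF matrix_mul_borel X] by simp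
    have "emeasure lborel (S \<inter> X) = emeasure (distr lborel borel ((**) V)) (S \<inter> X)"
      using lborel_distr_unitary[OF V] by simp
    also have "\<dots> = emeasure lborel ((**) V -` (S \<inter> X))"
      by (subst emeasure_distr) auto
    also have "(**) V -` (S \<inter> X) = S \<inter> ((**) V -` X)" using S by auto
    finally have "emeasure lborel (S \<inter> X) = emeasure lborel (S \<inter> ((**) V -` X))" .
    then show "emeasure (distr \<nu> borel ((**) V)) X = emeasure \<nu> X"
      using vim by (simp add: emeasure_distr \<nu>_def emeasure_uniform_measure)
  qed
  define \<mu> where "\<mu> = distr \<nu> borel (gs_matrix h)"
  have "prob_space \<mu>" unfolding \<mu>_def by (rule \<nu>.prob_space_distr) measurable
  moreover have "sets \<mu> = sets borel" by (simp add: \<mu>_def)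
  moreover have "AE U in \<mu>. unitary U"
  proof -
    have "{U :: 'n cmat. unitary U} \<in> sets borel" using closed_unitary by (rule borel_closed)
    moreover have "AE A in \<nu>. unitary (gs_matrix h A)"
      unfolding \<nu>_def
      by (rule AE_uniform_measureI[OF _ AE_I2])
         (use op gs_matrix_unitary[OF h] in \<open>auto dest: S_det\<close>)
    ultimately show ?thesis
      unfolding \<mu>_def by (subst AE_distr_iff) auto
  qed
  moreover have "distr \<mu> borel (\<lambda>U. V ** U) = \<mu>" if V: "unitary V" for V
  proof -
    have "distr \<mu> borel (\<lambda>U. V ** U) = distr \<nu> borel (\<lambda>A. V ** gs_matrix h A)"
      unfolding \<mu>_def by (subst distr_distr) (auto simp: o_def)
    \<comment> \<open>Equivariance of Gram-Schmidt moves \<open>V\<close> to the inside, where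
      invariance of \<open>\<nu>\<close> absorbs it.\<close>
    also have "\<dots> = distr \<nu> borel (gs_matrix h \<circ> (**) V)"
      using gs_matrix_equivariant[OF V] by (simp add: o_def)
    also have "\<dots> = distr (distr \<nu> borel ((**) V)) borel (gs_matrix h)"
      by (rule distr_distr[symmetric]) auto
    finally show ?thesis by (simp add: inv[OF V] \<mu>_def)
  qed
  ultimately show ?thesis unfolding haar_unitary_def by blast
qed

subsection \<open>The fourth moment of the trace\<close>

text \<open>The measure is concentrated on the compact unitary group, where a continuous function is
  bounded.\<close>

lemma haar_integrable:
  fixes f :: "'n::finite cmat \<Rightarrow> complex"
  assumes \<mu>: "haar_unitary \<mu>" and f: "continuous_on UNIV f"
  shows "integrable \<mu> f"
proof -
  interpret prob_space \<mu> using \<mu> by (simp add: haar_unitary_def)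
  have "compact (f ` {U. unitary U})"
    by (rule compact_continuous_image[OF continuous_on_subset[OF f] compact_unitary]) simp
  then have "bounded (f ` {U. unitary U})" by (rule compact_imp_bounded)
  then obtain B where B: "\<And>U. unitary U \<Longrightarrow> norm (f U) \<le> B"
    by (auto simp: bounded_iff)
  have "AE U in \<mu>. norm (f U) \<le> B"
    using \<mu> unfolding haar_unitary_def by (auto elim!: eventually_mono intro: B)
  moreover have "f \<in> borel_measurable \<mu>"
    using borel_measurable_continuous_onI[OF f] \<mu> by (simp add: haar_unitary_def cong: measurable_cong_sets)
  ultimately show ?thesis by (rule integrable_const_bound)
qed

lemma haar_shift:
  fixes f :: "'n::finite cmat \<Rightarrow> complex"
  assumes \<mu>: "haar_unitary \<mu>" and V: "unitary V" and f: "continuous_on UNIV f"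
  shows "(\<integral>U. f (V ** U) \<partial>\<mu>) = (\<integral>U. f U \<partial>\<mu>)"
proof -
  have [measurable_cong]: "sets \<mu> = sets borel" using \<mu> by (simp add: haar_unitary_def)
  have [measurable]: "f \<in> borel_measurable borel" by (rule borel_measurable_continuous_onI[OF f])
  have "(\<integral>U. f U \<partial>\<mu>) = (\<integral>U. f U \<partial>(distr \<mu> borel (\<lambda>U. V ** U)))"
    using \<mu> V by (simp add: haar_unitary_def)
  also have "\<dots> = (\<integral>U. f (V ** U) \<partial>\<mu>)"
    by (rule integral_distr) auto
  finally show ?thesis by simp
qed

lemma haar_integral_cong:
  fixes f :: "'n::finite cmat \<Rightarrow> complex"
  assumes \<mu>: "haar_unitary \<mu>" and f: "continuous_on UNIV f" "continuous_on UNIV g"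
    and eq: "\<And>U. unitary U \<Longrightarrow> f U = g U"
  shows "(\<integral>U. f U \<partial>\<mu>) = (\<integral>U. g U \<partial>\<mu>)"
proof (rule integral_cong_AE)
  show "f \<in> borel_measurable \<mu>" "g \<in> borel_measurable \<mu>"
    using haar_integrable[OF \<mu>] f by (auto intro: borel_measurable_integrable)
  show "AE U in \<mu>. f U = g U"
    using \<mu> unfolding haar_unitary_def by (auto elim!: eventually_mono intro: eq)
qed

lemma haar_integral_const: "haar_unitary \<mu> \<Longrightarrow> (\<integral>U. c \<partial>\<mu>) = (c::complex)"
  by (simp add: haar_unitary_def prob_space.prob_space)

lemma haar_integral_sum:
  fixes f :: "'i \<Rightarrow> 'n::finite cmat \<Rightarrow> complex"
  assumes "haar_unitary \<mu>" and "\<And>i. i \<in> I \<Longrightarrow> continuous_on UNIV (f i)"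
  shows "(\<integral>U. (\<Sum>i\<in>I. f i U) \<partial>\<mu>) = (\<Sum>i\<in>I. \<integral>U. f i U \<partial>\<mu>)"
  using assms by (intro Bochner_Integration.integral_sum haar_integrable)

text \<open>Diagonal phases, row swaps and rotations in two rows are all complex reflections of this kind.\<close>
definition creflect :: "('n::finite \<Rightarrow> complex) \<Rightarrow> complex \<Rightarrow> 'n cmat" where
  "creflect z \<zeta> = (\<chi> r c. (if r = c then 1 else 0) + (\<zeta> - 1) * z r * cnj (z c))"

lemma creflect_mul:
  "(creflect z \<zeta> ** U) $ r $ c = U $ r $ c + (\<zeta> - 1) * z r * (\<Sum>s\<in>UNIV. cnj (z s) * U $ s $ c)"
  by (simp add: creflect_def matrix_matrix_mult_def distrib_right sum.distrib sum_distrib_left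
      if_distrib[of "\<lambda>x. x * _"] mult.assoc cong: if_cong)

text \<open>For a unit vector \<open>z\<close> the matrix multiplies \<open>z\<close> by
  \<open>\<zeta>\<close> and fixes its orthogonal complement. The adjoint has parameter
  \<open>cnj \<zeta>\<close>, and the two parameters multiply to 1.\<close>

lemma unitary_creflect:
  assumes z: "(\<Sum>s\<in>UNIV. cnj (z s) * z s) = 1" and \<zeta>: "cmod \<zeta> = 1"
  shows "unitary (creflect z \<zeta>)"
proof -
  have \<zeta>': "cnj \<zeta> * \<zeta> = 1" using \<zeta> by (metis complex_norm_square mult.commute of_real_1 one_power2)
  have adj: "cadj (creflect z \<zeta>) = creflect z (cnj \<zeta>)"
    by (auto simp: cadj_def creflect_def vec_eq_iff)
  have "(creflect z (cnj \<zeta>) ** creflect z \<zeta>) $ r $ c = (if r = c then 1 else 0)" for r c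
  proof -
    have "(\<Sum>s\<in>UNIV. cnj (z s) * creflect z \<zeta> $ s $ c)
        = cnj (z c) + (\<zeta> - 1) * cnj (z c) * (\<Sum>s\<in>UNIV. cnj (z s) * z s)"
      by (simp add: creflect_def distrib_left sum.distrib sum_distrib_left
          if_distrib[of "\<lambda>x. _ * x"] mult_ac cong: if_cong)
    also have "\<dots> = \<zeta> * cnj (z c)" unfolding z by (simp add: algebra_simps)
    finally have s: "(\<Sum>s\<in>UNIV. cnj (z s) * creflect z \<zeta> $ s $ c) = \<zeta> * cnj (z c)" .
    have "(creflect z (cnj \<zeta>) ** creflect z \<zeta>) $ r $ c
        = (if r = c then 1 else 0) + z r * cnj (z c) * ((\<zeta> - 1) + (cnj \<zeta> * \<zeta> - \<zeta>))"
      unfolding creflect_mul s by (simp add: creflect_def algebra_simps)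
    then show ?thesis by (simp add: \<zeta>')
  qed
  then show ?thesis by (simp add: unitary_def adj vec_eq_iff mat_def)
qed

definition phase_matrix :: "'n::finite \<Rightarrow> 'n cmat" where
  "phase_matrix t = creflect (\<lambda>s. if s = t then 1 else 0) \<i>"

lemma unitary_phase_matrix: "unitary (phase_matrix t)"
  unfolding phase_matrix_def by (rule unitary_creflect) (simp_all add: if_distrib cong: if_cong)

lemma phase_matrix_mul: "(phase_matrix t ** U) $ r $ c = (if r = t then \<i> else 1) * U $ r $ c"
  by (simp add: phase_matrix_def creflect_mul if_distrib[of cnj] if_distrib[of "\<lambda>x. x * _"]
      cong: if_cong) (simp add: algebra_simps)

text \<open>A reflection along the normalised difference of the unit vectors at \<open>a\<close> and
  \<open>b\<close>. The parameter -1 exchanges rows \<open>a\<close> and \<open>b\<close>; the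
  parameter \<open>\<i>\<close> mixes them with weights of equal modulus.\<close>

definition pair_reflect :: "'n::finite \<Rightarrow> 'n \<Rightarrow> complex \<Rightarrow> 'n cmat" where
  "pair_reflect a b \<zeta> =
     creflect (\<lambda>s. of_real (1 / sqrt 2) * (if s = a then 1 else if s = b then -1 else 0)) \<zeta>"

lemma sum_two_points:
  fixes g :: "'n::finite \<Rightarrow> complex"
  assumes "a \<noteq> b" and "\<And>s. s \<noteq> a \<Longrightarrow> s \<noteq> b \<Longrightarrow> g s = 0"
  shows "(\<Sum>s\<in>UNIV. g s) = g a + g b"
proof -
  have "(\<Sum>s\<in>UNIV. g s) = (\<Sum>s\<in>{a, b}. g s)"
    by (rule sum.mono_neutral_right) (use assms in auto)
  then show ?thesis using assms by simp
qed

lemma inverse_sqrt2_sq: "complex_of_real (1 / sqrt 2) * of_real (1 / sqrt 2) = 1/2"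
  by (simp add: of_real_mult[symmetric] del: of_real_mult)

lemma unitary_pair_reflect:
  assumes "a \<noteq> b" "cmod \<zeta> = 1" shows "unitary (pair_reflect a b \<zeta>)"
  unfolding pair_reflect_def
proof (rule unitary_creflect)
  show "(\<Sum>s\<in>UNIV. cnj (of_real (1 / sqrt 2) * (if s = a then 1 else if s = b then -1 else 0)) *
         (of_real (1 / sqrt 2) * (if s = a then 1 else if s = b then -1 else 0))) = (1::complex)"
    using assms(1) inverse_sqrt2_sq by (subst sum_two_points[of a b]) auto
qed (fact assms)

lemma pair_reflect_mul:
  assumes "a \<noteq> b"
  shows "(pair_reflect a b \<zeta> ** U) $ r $ c =
    (if r = a then (1 + \<zeta>) / 2 * U $ a $ c + (1 - \<zeta>) / 2 * U $ b $ c
     else if r = b then (1 - \<zeta>) / 2 * U $ a $ c + (1 + \<zeta>) / 2 * U $ b $ c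
     else U $ r $ c)"
proof -
  let ?h = "complex_of_real (1 / sqrt 2)"
  have "(\<Sum>s\<in>UNIV. cnj (?h * (if s = a then 1 else if s = b then -1 else 0)) * U $ s $ c)
      = ?h * (U $ a $ c - U $ b $ c)"
    using assms by (subst sum_two_points[of a b]) (auto simp: algebra_simps)
  then have eq: "(pair_reflect a b \<zeta> ** U) $ r $ c = U $ r $ c + 
     (\<zeta> - 1) * (if r = a then 1 else if r = b then -1 else 0) * (?h * ?h) * (U $ a $ c - U $ b $ c)"
    unfolding pair_reflect_def creflect_mul by (simp only: mult_ac)
  show ?thesis unfolding eq inverse_sqrt2_sq using assms by (simp add: field_simps)
qed

section \<open>Fourth-order moments of matrix entries\<close>

definition moment :: "'n::finite cmat measure \<Rightarrow> 'n \<times> 'n \<Rightarrow> 'n \<times> 'n \<Rightarrow> 'n \<times> 'n \<Rightarrow> 'n \<times> 'n \<Rightarrow> complex" where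
  "moment \<mu> p q r s = (\<integral>U. U $ fst p $ snd p * U $ fst q $ snd q *
     cnj (U $ fst r $ snd r) * cnj (U $ fst s $ snd s) \<partial>\<mu>)"

lemma haar_fourfold:
  fixes f g h k :: "'i \<Rightarrow> 'n::finite cmat \<Rightarrow> complex"
  assumes \<mu>: "haar_unitary \<mu>"
    and c: "\<And>i. continuous_on UNIV (f i)" "\<And>i. continuous_on UNIV (g i)"
      "\<And>i. continuous_on UNIV (h i)" "\<And>i. continuous_on UNIV (k i)"
  shows "(\<integral>U. (\<Sum>i\<in>I. f i U) * (\<Sum>i\<in>I. g i U) * (\<Sum>i\<in>I. h i U) * (\<Sum>i\<in>I. k i U) \<partial>\<mu>)
    = (\<Sum>p\<in>I. \<Sum>q\<in>I. \<Sum>r\<in>I. \<Sum>s\<in>I. \<integral>U. f p U * g q U * h r U * k s U \<partial>\<mu>)"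
proof -
  have "(\<Sum>i\<in>I. f i U) * (\<Sum>i\<in>I. g i U) * (\<Sum>i\<in>I. h i U) * (\<Sum>i\<in>I. k i U)
      = (\<Sum>p\<in>I. \<Sum>q\<in>I. \<Sum>r\<in>I. \<Sum>s\<in>I. f p U * g q U * h r U * k s U)" for U
    by (simp only: sum_distrib_left[symmetric] sum_distrib_right[symmetric])
  then have "(\<integral>U. (\<Sum>i\<in>I. f i U) * (\<Sum>i\<in>I. g i U) * (\<Sum>i\<in>I. h i U) * (\<Sum>i\<in>I. k i U) \<partial>\<mu>)
      = (\<integral>U. (\<Sum>p\<in>I. \<Sum>q\<in>I. \<Sum>r\<in>I. \<Sum>s\<in>I. f p U * g q U * h r U * k s U) \<partial>\<mu>)"
    by (simp only:)
  also have "\<dots> = (\<Sum>p\<in>I. \<integral>U. (\<Sum>q\<in>I. \<Sum>r\<in>I. \<Sum>s\<in>I. f p U * g q U * h r U * k s U) \<partial>\<mu>)"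
    by (rule haar_integral_sum[OF \<mu>]) (intro continuous_intros c)
  also have "\<dots> = (\<Sum>p\<in>I. \<Sum>q\<in>I. \<integral>U. (\<Sum>r\<in>I. \<Sum>s\<in>I. f p U * g q U * h r U * k s U) \<partial>\<mu>)"
    by (intro sum.cong refl haar_integral_sum[OF \<mu>] continuous_intros c)
  also have "\<dots> = (\<Sum>p\<in>I. \<Sum>q\<in>I. \<Sum>r\<in>I. \<integral>U. (\<Sum>s\<in>I. f p U * g q U * h r U * k s U) \<partial>\<mu>)"
    by (intro sum.cong refl haar_integral_sum[OF \<mu>] continuous_intros c)
  also have "\<dots> = (\<Sum>p\<in>I. \<Sum>q\<in>I. \<Sum>r\<in>I. \<Sum>s\<in>I. \<integral>U. f p U * g q U * h r U * k s U \<partial>\<mu>)"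
    by (intro sum.cong refl haar_integral_sum[OF \<mu>] continuous_intros c)
  finally show ?thesis .
qed

text \<open>Multiplying row \<open>t\<close> by \<open>\<i>\<close> preserves the integral but
  scales it by a power of \<open>\<i>\<close>, whose exponent counts \<open>t\<close> among the
  plain rows minus among the conjugated rows. Nonzero moments thus need equal multisets of
  rows.\<close>

lemma moment_zero:
  assumes \<mu>: "haar_unitary \<mu>"
    and ne: "\<not> (fst p = fst r \<and> fst q = fst s)" "\<not> (fst p = fst s \<and> fst q = fst r)"
  shows "moment \<mu> p q r s = 0"
proof -
  define ph where "ph t x = (if x = t then \<i> else 1)" for t x :: 'a
  have eq: "moment \<mu> p q r s = ph t (fst p) * ph t (fst q) * cnj (ph t (fst r)) * cnj (ph t (fst s))
      * moment \<mu> p q r s" for t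
  proof -
    have "moment \<mu> p q r s = (\<integral>U. (\<lambda>U. U $ fst p $ snd p * U $ fst q $ snd q *
     cnj (U $ fst r $ snd r) * cnj (U $ fst s $ snd s)) (phase_matrix t ** U) \<partial>\<mu>)"
      unfolding moment_def
      by (rule haar_shift[symmetric, OF \<mu> unitary_phase_matrix]) (intro continuous_intros)
    also have "\<dots> = (\<integral>U. (ph t (fst p) * ph t (fst q) * cnj (ph t (fst r)) * cnj (ph t (fst s))) *
        (U $ fst p $ snd p * U $ fst q $ snd q * cnj (U $ fst r $ snd r) * cnj (U $ fst s $ snd s)) \<partial>\<mu>)"
      by (simp only: phase_matrix_mul ph_def[symmetric] complex_cnj_mult mult_ac)
    finally show ?thesis by (simp add: moment_def)
  qed
  have "\<exists>t. ph t (fst p) * ph t (fst q) * cnj (ph t (fst r)) * cnj (ph t (fst s)) \<noteq> 1"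
  proof (rule ccontr)
    assume "\<not> ?thesis"
    then have h: "ph t (fst p) * ph t (fst q) * cnj (ph t (fst r)) * cnj (ph t (fst s)) = 1" for t by blast
    \<comment> \<open>Otherwise the row of \<open>p\<close> occurs once or twice and is never
      compensated, so the factor is \<open>\<i>\<close> or -1. The row of \<open>q\<close> is
      treated in the same way afterwards.\<close>
    have "fst p = fst r \<or> fst p = fst s"
    proof (rule ccontr)
      assume "\<not> ?thesis"
      then show False using h[of "fst p"] by (cases "fst q = fst p") (auto simp: ph_def)
    qed
    then show False
    proof
      assume "fst p = fst r"
      then show False using ne h[of "fst q"] by (cases "fst q = fst p") (auto simp: ph_def)
    next
      assume "fst p = fst s"
      then show False using ne h[of "fst q"] by (cases "fst q = fst p") (auto simp: ph_def)
    qed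
  qed
  then show ?thesis using eq by (metis mult_cancel_right1)
qed

lemma moment_swap:
  fixes \<mu> :: "'n::finite cmat measure"
  assumes \<mu>: "haar_unitary \<mu>" and "a \<noteq> b"
  defines "\<tau> \<equiv> Transposition.transpose a b"
  shows "moment \<mu> (\<tau> p, i) (\<tau> q, j) (\<tau> r, k) (\<tau> s, l) = moment \<mu> (p, i) (q, j) (r, k) (s, l)"
proof -
  have "moment \<mu> (p, i) (q, j) (r, k) (s, l) = (\<integral>U. (\<lambda>U. U $ p $ i * U $ q $ j *
     cnj (U $ r $ k) * cnj (U $ s $ l)) (pair_reflect a b (-1) ** U) \<partial>\<mu>)"
    unfolding moment_def fst_conv snd_conv
    by (rule haar_shift[symmetric, OF \<mu> unitary_pair_reflect]) (use assms in \<open>auto intro!: continuous_intros\<close>)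
  moreover have "(pair_reflect a b (-1) ** U) $ t $ c = U $ \<tau> t $ c" for t c and U :: "'n cmat"
    using assms by (simp add: pair_reflect_mul Transposition.transpose_def)
  ultimately show ?thesis by (simp add: moment_def)
qed

text \<open>Phases and permutations alone do not relate moments with equal rows to those with
  distinct rows; mixing two rows supplies this relation.\<close>

lemma moment_rotate:
  fixes \<mu> :: "'n::finite cmat measure" and i j :: 'n
  assumes \<mu>: "haar_unitary \<mu>" and ab: "a \<noteq> b"
  defines "M \<equiv> \<lambda>p q r s. moment \<mu> (p, i) (q, j) (r, i) (s, j)"
  shows "4 * M a a a a = M a a a a + M a b a b + M b a b a + M b b b b + M a b b a + M b a a b"
proof -
  \<comment> \<open>Row \<open>a\<close> of \<open>pair_reflect a b \<i>\<close>; only its entries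
    at \<open>a\<close> and \<open>b\<close> matter.\<close>
  define z where "z s = (if s = a then (1 + \<i>) / 2 else (1 - \<i>) / 2)" for s :: 'n
  have "M a a a a = (\<integral>U. (\<lambda>U. U $ a $ i * U $ a $ j *
     cnj (U $ a $ i) * cnj (U $ a $ j)) (pair_reflect a b \<i> ** U) \<partial>\<mu>)"
    unfolding moment_def M_def fst_conv snd_conv
    by (rule haar_shift[symmetric, OF \<mu> unitary_pair_reflect[OF ab]]) (auto intro!: continuous_intros)
  also have "\<dots> = (\<integral>U. (\<Sum>s\<in>{a, b}. z s * U $ s $ i) * (\<Sum>s\<in>{a, b}. z s * U $ s $ j) *
     (\<Sum>s\<in>{a, b}. cnj (z s * U $ s $ i)) * (\<Sum>s\<in>{a, b}. cnj (z s * U $ s $ j)) \<partial>\<mu>)"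
    using ab by (simp add: pair_reflect_mul z_def)
  also have "\<dots> = (\<Sum>p\<in>{a, b}. \<Sum>q\<in>{a, b}. \<Sum>r\<in>{a, b}. \<Sum>s\<in>{a, b}.
      \<integral>U. (z p * U $ p $ i) * (z q * U $ q $ j) * cnj (z r * U $ r $ i) * cnj (z s * U $ s $ j) \<partial>\<mu>)"
    by (rule haar_fourfold[OF \<mu>]) (intro continuous_intros)+
  also have "\<dots> = (\<Sum>p\<in>{a, b}. \<Sum>q\<in>{a, b}. \<Sum>r\<in>{a, b}. \<Sum>s\<in>{a, b}.
      z p * z q * cnj (z r) * cnj (z s) * M p q r s)"
  proof (intro sum.cong refl)
    fix p q r s
    have "(\<integral>U. (z p * U $ p $ i) * (z q * U $ q $ j) * cnj (z r * U $ r $ i) * cnj (z s * U $ s $ j) \<partial>\<mu>)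
      = (\<integral>U. (z p * z q * cnj (z r) * cnj (z s)) * (U $ p $ i * U $ q $ j * cnj (U $ r $ i) * cnj (U $ s $ j)) \<partial>\<mu>)"
      by (simp only: mult_ac complex_cnj_mult)
    then show "(\<integral>U. (z p * U $ p $ i) * (z q * U $ q $ j) * cnj (z r * U $ r $ i) * cnj (z s * U $ s $ j) \<partial>\<mu>)
      = z p * z q * cnj (z r) * cnj (z s) * M p q r s"
      by (simp add: M_def moment_def)
  qed
  also have "\<dots> = (M a a a a + M a b a b + M b a b a + M b b b b + M a b b a + M b a a b) / 4"
  proof -
    have zero: "M p q r s = 0" if "\<not> (p = r \<and> q = s)" "\<not> (p = s \<and> q = r)" for p q r s
      unfolding M_def using that by (intro moment_zero[OF \<mu>]) auto
    have zz: "z s * cnj (z s) = 1/2" for s by (simp add: z_def complex_eq_iff)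
    \<comment> \<open>In a nonvanishing term each coefficient meets its own conjugate, giving 1/2
      twice. Of the 16 terms, six survive.\<close>
    have coef: "z p * z q * cnj (z r) * cnj (z s) * M p q r s = M p q r s / 4" for p q r s
    proof (cases "p = r \<and> q = s \<or> p = s \<and> q = r")
      case True
      then have "z p * z q * cnj (z r) * cnj (z s) = (z p * cnj (z p)) * (z q * cnj (z q))" by auto
      then show ?thesis by (simp only: zz) simp
    next
      case False then show ?thesis using zero by auto
    qed
    show ?thesis using ab unfolding coef by (simp add: zero add_divide_distrib)
  qed
  finally show ?thesis by simp
qed

text \<open>Transpositions act transitively on points and on ordered pairs of distinct
  points.\<close>

lemma transpose_invariant_two_points:
  assumes inv: "\<And>a b p q. a \<noteq> b \<Longrightarrow>
    F (Transposition.transpose a b p) (Transposition.transpose a b q) = F p q"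
  shows "F p p = F p' p'" and "p \<noteq> q \<Longrightarrow> p' \<noteq> q' \<Longrightarrow> F p q = F p' q'"
proof -
  have first: "\<exists>q1. F p q = F p' q1 \<and> (q1 = p' \<longleftrightarrow> q = p)" for q
  proof (cases "p = p'")
    case False
    have "F p q = F p' (Transposition.transpose p p' q)"
      using inv[OF False, of p q] by simp
    moreover have "Transposition.transpose p p' q = p' \<longleftrightarrow> q = p"
      using False by (auto simp: Transposition.transpose_def split: if_splits)
    ultimately show ?thesis by blast
  qed auto
  show "F p p = F p' p'" using first[of p] by auto
  assume "p \<noteq> q" "p' \<noteq> q'"
  with first[of q] obtain q1 where q1: "F p q = F p' q1" "q1 \<noteq> p'" by auto
  show "F p q = F p' q'"
  proof (cases "q1 = q'")
    case False
    \<comment> \<open>Swapping \<open>q1\<close> and \<open>q'\<close> fixes \<open>p'\<close>,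
      which differs from both.\<close>
    then show ?thesis using inv[of q1 q' p' q1] q1 \<open>p' \<noteq> q'\<close> by simp
  qed (use q1 in simp)
qed

lemma sum_const_off_diagonal:
  fixes g p :: complex
  assumes "\<And>a. F a a = g" and "\<And>a b. a \<noteq> b \<Longrightarrow> F a b = p"
  shows "(\<Sum>a\<in>UNIV. \<Sum>b\<in>UNIV. F a (b :: 'n::finite))
    = of_nat CARD('n) * g + of_nat CARD('n) * (of_nat CARD('n) - 1) * p"
proof -
  have row: "(\<Sum>b\<in>UNIV. F a b) = g + (of_nat CARD('n) - 1) * p" for a
  proof -
    have "(\<Sum>b\<in>UNIV. F a b) = (\<Sum>b\<in>UNIV. (if b = a then g - p else 0) + p)"
      by (rule sum.cong) (use assms in auto)
    also have "\<dots> = g - p + of_nat CARD('n) * p" by (simp add: sum.distrib)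
    finally show ?thesis by (simp add: algebra_simps)
  qed
  show ?thesis unfolding row by (simp add: algebra_simps)
qed

text \<open>Under the integral the double sum factors into two inner products of columns, which are
  orthonormal.\<close>

lemma moment_row_sum:
  fixes \<mu> :: "'n::finite cmat measure"
  assumes \<mu>: "haar_unitary \<mu>"
  shows "(\<Sum>a\<in>UNIV. \<Sum>b\<in>UNIV. moment \<mu> (a, i) (b, j) (a, k) (b, l)) = (if i = k \<and> j = l then 1 else 0)"
proof -
  have "(\<Sum>a\<in>UNIV. \<Sum>b\<in>UNIV. moment \<mu> (a, i) (b, j) (a, k) (b, l))
    = (\<Sum>a\<in>UNIV. \<integral>U. (\<Sum>b\<in>UNIV. U $ a $ i * U $ b $ j * cnj (U $ a $ k) * cnj (U $ b $ l)) \<partial>\<mu>)"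
    unfolding moment_def fst_conv snd_conv
    by (intro sum.cong refl haar_integral_sum[symmetric, OF \<mu>] continuous_intros)
  also have "\<dots> = (\<integral>U. (\<Sum>a\<in>UNIV. \<Sum>b\<in>UNIV. U $ a $ i * U $ b $ j * cnj (U $ a $ k) * cnj (U $ b $ l)) \<partial>\<mu>)"
    by (intro haar_integral_sum[symmetric, OF \<mu>] continuous_intros)
  also have "\<dots> = (\<integral>U. (if i = k \<and> j = l then 1 else 0) \<partial>\<mu>)"
  proof (rule haar_integral_cong[OF \<mu>])
    fix U :: "'n cmat" assume U: "unitary U"
    have "(\<Sum>a\<in>UNIV. \<Sum>b\<in>UNIV. U $ a $ i * U $ b $ j * cnj (U $ a $ k) * cnj (U $ b $ l))
      = (\<Sum>a\<in>UNIV. U $ a $ i * cnj (U $ a $ k)) * (\<Sum>b\<in>UNIV. U $ b $ j * cnj (U $ b $ l))"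
      unfolding sum_product by (intro sum.cong refl) (simp only: mult_ac)
    then show "(\<Sum>a\<in>UNIV. \<Sum>b\<in>UNIV. U $ a $ i * U $ b $ j * cnj (U $ a $ k) * cnj (U $ b $ l))
      = (if i = k \<and> j = l then 1 else 0)"
      by (simp add: unitary_columns[OF U])
  qed (intro continuous_intros)+
  finally show ?thesis by (simp only: haar_integral_const[OF \<mu>])
qed

text \<open>For fixed columns, row symmetry leaves three unknowns: \<open>G\<close> at equal rows,
  \<open>G\<close> at distinct rows and \<open>R\<close> at distinct rows. The rotation and the two
  row sums give three linear equations.\<close>

lemma moment_values:
  fixes \<mu> :: "'n::finite cmat measure" and i j :: 'n
  assumes \<mu>: "haar_unitary \<mu>" and n: "CARD('n) > 1"
  defines "N \<equiv> of_nat CARD('n) :: complex"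
  shows "moment \<mu> (i, i) (i, i) (i, i) (i, i) = 2 / (N * (N + 1))"
    and "i \<noteq> j \<Longrightarrow> moment \<mu> (i, i) (j, j) (i, i) (j, j) = 1 / ((N - 1) * (N + 1))"
proof -
  have N: "N \<noteq> 0" "N - 1 \<noteq> 0" "N + 1 \<noteq> 0"
  proof -
    have "Re N > 1" using n by (simp add: N_def)
    then show "N \<noteq> 0" "N - 1 \<noteq> 0" "N + 1 \<noteq> 0" by (auto simp: complex_eq_iff)
  qed
  obtain a b :: 'n where ab: "a \<noteq> b"
    using n card_le_Suc0_iff_eq[of "UNIV :: 'n set"] by auto
  \<comment> \<open>In \<open>G\<close> the conjugated factors repeat the two entries; in
    \<open>R\<close> their rows are crossed.\<close>
  define G where "G i j a b = moment \<mu> (a, i) (b, j) (a, i) (b, j)" for i j a b :: 'n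
  define R where "R i j a b = moment \<mu> (a, i) (b, j) (b, i) (a, j)" for i j a b :: 'n
  have G1: "G i j p p = G i j p' p'" and G2: "p \<noteq> q \<Longrightarrow> p' \<noteq> q' \<Longrightarrow> G i j p q = G i j p' q'" for i j p q p' q'
    using transpose_invariant_two_points[of "G i j", unfolded G_def, OF moment_swap[OF \<mu>]]
    unfolding G_def by blast+
  have R2: "p \<noteq> q \<Longrightarrow> p' \<noteq> q' \<Longrightarrow> R i j p q = R i j p' q'" for i j p q p' q'
    using transpose_invariant_two_points(2)[of "R i j", unfolded R_def, OF moment_swap[OF \<mu>]]
    unfolding R_def by blast
  have R1: "R i j p p = G i j p p" for i j p by (simp add: R_def G_def)
  have rot: "G i j a a = G i j a b + R i j a b" for i j
  proof -
    have "4 * G i j a a = G i j a a + G i j a b + G i j b a + G i j b b + R i j a b + R i j b a"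
      using moment_rotate[OF \<mu> ab, of i j] unfolding G_def R_def .
    moreover have "G i j b a = G i j a b" "G i j b b = G i j a a" "R i j b a = R i j a b"
      using ab G1 G2 R2 by metis+
    ultimately have "2 * G i j a a = 2 * (G i j a b + R i j a b)" by (simp add: algebra_simps)
    then show ?thesis by (simp only: mult_cancel_left) simp
  qed
  have Gsum: "N * G i j a a + N * (N - 1) * G i j a b = 1" for i j
  proof -
    have "(\<Sum>p\<in>UNIV. \<Sum>q\<in>UNIV. G i j p q) = 1" unfolding G_def by (simp add: moment_row_sum[OF \<mu>])
    moreover have "(\<Sum>p\<in>UNIV. \<Sum>q\<in>UNIV. G i j p q) = N * G i j a a + N * (N - 1) * G i j a b"
      unfolding N_def by (rule sum_const_off_diagonal) (rule G1, rule G2[OF _ ab])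
    ultimately show ?thesis by simp
  qed
  have Rsum: "N * G i j a a + N * (N - 1) * R i j a b = (if i = j then 1 else 0)" for i j
  proof -
    \<comment> \<open>Reordering the conjugated factors trades crossed rows for crossed columns, so
      orthogonality of columns applies.\<close>
    have "R i j p q = moment \<mu> (p, i) (q, j) (p, j) (q, i)" for p q
      by (simp add: R_def moment_def mult_ac)
    then have "(\<Sum>p\<in>UNIV. \<Sum>q\<in>UNIV. R i j p q) = (if i = j then 1 else 0)"
      by (simp add: moment_row_sum[OF \<mu>])
    moreover have "(\<Sum>p\<in>UNIV. \<Sum>q\<in>UNIV. R i j p q) = N * G i j a a + N * (N - 1) * R i j a b"
      unfolding N_def by (rule sum_const_off_diagonal) (simp only: R1, rule G1, rule R2[OF _ ab])
    ultimately show ?thesis by simp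
  qed
  show "moment \<mu> (i, i) (i, i) (i, i) (i, i) = 2 / (N * (N + 1))"
  proof -
    \<comment> \<open>With equal columns the two patterns coincide, which makes the equal-row moment
      twice the other one.\<close>
    have "G i i a b = R i i a b" by (simp add: G_def R_def moment_def mult_ac)
    then have "G i i a a = 2 * G i i a b" using rot[of i i] by simp
    then have "G i i a b * (N * (N + 1)) = 1" using Gsum[of i i] by (simp add: algebra_simps)
    then have "G i i a b = 1 / (N * (N + 1))" using N by (simp add: eq_divide_eq)
    then have "G i i a a = 2 / (N * (N + 1))" using \<open>G i i a a = 2 * G i i a b\<close> by simp
    then show ?thesis using G1[of i i a i] by (simp add: G_def)
  qed
  show "moment \<mu> (i, i) (j, j) (i, i) (j, j) = 1 / ((N - 1) * (N + 1))" if "i \<noteq> j"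
  proof -
    have "N * (G i j a a + (N - 1) * R i j a b) = 0" using Rsum[of i j] that by (simp add: algebra_simps)
    then have "G i j a a + (N - 1) * R i j a b = 0" using N by simp
    then have g: "G i j a a = - (N - 1) * R i j a b" by (simp only: eq_neg_iff_add_eq_0 mult_minus_left)
    then have p: "G i j a b = - N * R i j a b" using rot[of i j] by (simp add: algebra_simps eq_neg_iff_add_eq_0)
    have "G i j a b * ((N - 1) * (N + 1)) = 1"
      using Gsum[of i j] unfolding g p by (simp add: algebra_simps)
    then have "G i j a b = 1 / ((N - 1) * (N + 1))" using N by (simp add: eq_divide_eq)
    then show ?thesis using G2[OF ab that, of i j] by (simp add: G_def)
  qed
qed

lemma haar_trace_moment:
  fixes \<mu> :: "'n::finite cmat measure"
  assumes \<mu>: "haar_unitary \<mu>" and n: "CARD('n) > 1"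
  shows "(\<integral>U. ctrace U * ctrace U * cnj (ctrace U) * cnj (ctrace U) \<partial>\<mu>) = 2"
proof -
  define N where "N = (of_nat CARD('n) :: complex)"
  have N: "N \<noteq> 0" "N - 1 \<noteq> 0" "N + 1 \<noteq> 0"
  proof -
    have "Re N > 1" using n by (simp add: N_def)
    then show "N \<noteq> 0" "N - 1 \<noteq> 0" "N + 1 \<noteq> 0" by (auto simp: complex_eq_iff)
  qed
  define M where "M p q r s = moment \<mu> (p, p) (q, q) (r, r) (s, s)" for p q r s
  have zero: "M p q r s = 0" if "\<not> (p = r \<and> q = s)" "\<not> (p = s \<and> q = r)" for p q r s
    unfolding M_def using that by (intro moment_zero[OF \<mu>]) auto
  \<comment> \<open>The index set is a set of pairs: it has one element when \<open>p = q\<close>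
    and two otherwise, so equal indices are not counted twice.\<close>
  have inner: "(\<Sum>r\<in>UNIV. \<Sum>s\<in>UNIV. M p q r s) = (\<Sum>x\<in>{(p, q), (q, p)}. M p q (fst x) (snd x))" for p q
  proof -
    have "(\<Sum>r\<in>UNIV. \<Sum>s\<in>UNIV. M p q r s) = (\<Sum>x\<in>UNIV. M p q (fst x) (snd x))"
      by (simp add: sum.cartesian_product case_prod_beta)
    also have "\<dots> = (\<Sum>x\<in>{(p, q), (q, p)}. M p q (fst x) (snd x))"
      by (rule sum.mono_neutral_right) (auto intro!: zero)
    finally show ?thesis .
  qed
  have diag: "(\<Sum>r\<in>UNIV. \<Sum>s\<in>UNIV. M p p r s) = 2 / (N * (N + 1))" for p
    unfolding inner using moment_values(1)[OF \<mu> n] by (simp add: M_def N_def)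
  have off: "(\<Sum>r\<in>UNIV. \<Sum>s\<in>UNIV. M p q r s) = 2 / ((N - 1) * (N + 1))" if "p \<noteq> q" for p q
  proof -
    have "M p q q p = M p q p q" by (simp add: M_def moment_def mult_ac)
    then show ?thesis
      unfolding inner using that moment_values(2)[OF \<mu> n that] by (simp add: M_def N_def)
  qed
  have "(\<integral>U. ctrace U * ctrace U * cnj (ctrace U) * cnj (ctrace U) \<partial>\<mu>)
    = (\<integral>U. (\<Sum>i\<in>UNIV. U $ i $ i) * (\<Sum>i\<in>UNIV. U $ i $ i) * (\<Sum>i\<in>UNIV. cnj (U $ i $ i)) * (\<Sum>i\<in>UNIV. cnj (U $ i $ i)) \<partial>\<mu>)"
    by (simp add: ctrace_def)
  also have "\<dots> = (\<Sum>p\<in>UNIV. \<Sum>q\<in>UNIV. \<Sum>r\<in>UNIV. \<Sum>s\<in>UNIV. M p q r s)"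
    unfolding M_def moment_def fst_conv snd_conv
    by (rule haar_fourfold[OF \<mu>]) (intro continuous_intros)+
  also have "\<dots> = N * (2 / (N * (N + 1))) + N * (N - 1) * (2 / ((N - 1) * (N + 1)))"
    unfolding N_def by (rule sum_const_off_diagonal) (use diag off in \<open>auto simp: N_def\<close>)
  also have "\<dots> = 2 / (N + 1) + 2 * N / (N + 1)" using N by simp
  also have "\<dots> = 2 * (N + 1) / (N + 1)" by (simp add: add_divide_distrib[symmetric] algebra_simps)
  also have "\<dots> = 2" using N(3) by (rule nonzero_mult_div_cancel_right)
  finally show ?thesis .
qed

section \<open>From the trace moment to weighted designs\<close>

lemma ctrace_cadj_mul:
  "ctrace (cadj A ** B) = (\<Sum>p\<in>UNIV. cnj (A $ fst p $ snd p) * B $ fst p $ snd p)"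
proof -
  have "ctrace (cadj A ** B) = (\<Sum>j\<in>UNIV. \<Sum>i\<in>UNIV. cnj (A $ i $ j) * B $ i $ j)"
    by (simp add: ctrace_def cadj_def matrix_matrix_mult_def)
  also have "\<dots> = (\<Sum>i\<in>UNIV. \<Sum>j\<in>UNIV. cnj (A $ i $ j) * B $ i $ j)" by (rule sum.swap)
  finally show ?thesis by (simp add: sum.cartesian_product case_prod_beta)
qed

lemma unitary_cadj: "unitary U \<Longrightarrow> unitary (cadj U)"
  using unitary_right by (simp add: unitary_def) (simp add: cadj_def vec_lambda_eta)

lemma of_real_cmod_power4: "complex_of_real (cmod z ^ 4) = z * z * cnj z * cnj z"
proof -
  have "complex_of_real (cmod z ^ 4) = (complex_of_real ((cmod z)\<^sup>2))\<^sup>2" by simp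
  then show ?thesis unfolding complex_norm_square by (simp add: power2_eq_square mult_ac)
qed

text \<open>The fourth power is a linear combination of entries of \<open>tens22 U\<close>.
  Conjugated entries of \<open>U\<close> are transposed entries of \<open>cadj U\<close>, hence the
  exchange of \<open>fst\<close> and \<open>snd\<close> in the last two slots.\<close>

lemma trace_fourth_power_tens22:
  fixes Y U :: "'n::finite cmat"
  defines "c \<equiv> \<lambda>p q r s. cnj (Y $ fst p $ snd p) * cnj (Y $ fst q $ snd q) *
    Y $ fst r $ snd r * Y $ fst s $ snd s"
  shows "complex_of_real ((cmod (ctrace (cadj Y ** U))) ^ 4) =
    (\<Sum>p\<in>UNIV. \<Sum>q\<in>UNIV. \<Sum>r\<in>UNIV. \<Sum>s\<in>UNIV.
       c p q r s * tens22 U (fst p, fst q, snd r, snd s) (snd p, snd q, fst r, fst s))"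
proof -
  let ?t = "ctrace (cadj Y ** U)"
  have "complex_of_real ((cmod ?t) ^ 4) = ?t * ?t * cnj ?t * cnj ?t"
    by (rule of_real_cmod_power4)
  also have "\<dots> = (\<Sum>p\<in>UNIV. \<Sum>q\<in>UNIV. \<Sum>r\<in>UNIV. \<Sum>s\<in>UNIV.
       (cnj (Y $ fst p $ snd p) * U $ fst p $ snd p) * (cnj (Y $ fst q $ snd q) * U $ fst q $ snd q)
       * cnj (cnj (Y $ fst r $ snd r) * U $ fst r $ snd r) * cnj (cnj (Y $ fst s $ snd s) * U $ fst s $ snd s))"
    unfolding ctrace_cadj_mul cnj_sum
    by (simp only: sum_distrib_left[symmetric] sum_distrib_right[symmetric])
  also have "\<dots> = (\<Sum>p\<in>UNIV. \<Sum>q\<in>UNIV. \<Sum>r\<in>UNIV. \<Sum>s\<in>UNIV.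
       c p q r s * tens22 U (fst p, fst q, snd r, snd s) (snd p, snd q, fst r, fst s))"
    by (intro sum.cong refl) (simp add: c_def tens22_def cadj_def)
  finally show ?thesis .
qed

lemma continuous_on_tens22: "continuous_on UNIV (\<lambda>U :: 'n::finite cmat. tens22 U I J)"
  unfolding tens22_def cadj_def case_prod_beta vec_lambda_beta by (intro continuous_intros)

text \<open>Left invariance under \<open>cadj Y\<close> removes \<open>Y\<close> and leaves the
  moment of the bare trace.\<close>

lemma haar_trace_fourth_power:
  fixes \<mu> :: "'n::finite cmat measure"
  assumes \<mu>: "haar_unitary \<mu>" and n: "CARD('n) > 1" and Y: "unitary Y"
  shows "(\<integral>U. complex_of_real ((cmod (ctrace (cadj Y ** U))) ^ 4) \<partial>\<mu>) = 2"
proof -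
  have "(\<integral>U. ctrace (cadj Y ** U) * ctrace (cadj Y ** U) * cnj (ctrace (cadj Y ** U)) * cnj (ctrace (cadj Y ** U)) \<partial>\<mu>)
    = (\<integral>U. ctrace U * ctrace U * cnj (ctrace U) * cnj (ctrace U) \<partial>\<mu>)"
    by (rule haar_shift[OF \<mu> unitary_cadj[OF Y]]) (unfold ctrace_def, intro continuous_intros)
  then show ?thesis using haar_trace_moment[OF \<mu> n] by (simp only: of_real_cmod_power4)
qed

text \<open>The design identity holds entrywise, hence for every fixed linear combination of entries
  of \<open>tens22\<close>.\<close>

lemma design_trace_fourth_power:
  fixes D :: "'n::finite cmat set set"
  assumes D: "weighted_2_design D w" and n: "CARD('n) > 1" and Y: "unitary Y"
  shows "(\<Sum>x\<in>D. w x * (cmod (ctrace (cadj Y ** rep x))) ^ 4) = 2"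
proof -
  obtain \<mu> :: "'n cmat measure" where \<mu>: "haar_unitary \<mu>" using haar_unitary_exists by blast
  define c where "c p q r s = cnj (Y $ fst p $ snd p) * cnj (Y $ fst q $ snd q) *
    Y $ fst r $ snd r * Y $ fst s $ snd s" for p q r s
  define T where "T U p q r s = tens22 U (fst p, fst q, snd r, snd s) (snd p, snd q, fst r, fst s)"
    for U :: "'n cmat" and p q r s
  have expand: "complex_of_real ((cmod (ctrace (cadj Y ** U))) ^ 4) =
    (\<Sum>p\<in>UNIV. \<Sum>q\<in>UNIV. \<Sum>r\<in>UNIV. \<Sum>s\<in>UNIV. c p q r s * T U p q r s)" for U
    unfolding c_def T_def by (rule trace_fourth_power_tens22)
  have T: "(\<Sum>x\<in>D. of_real (w x) * T (rep x) p q r s) = (\<integral>U. T U p q r s \<partial>\<mu>)" for p q r s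
    using D \<mu> unfolding weighted_2_design_def T_def by blast
  have cont: "continuous_on UNIV (\<lambda>U. T U p q r s)" for p q r s
    unfolding T_def by (rule continuous_on_tens22)
  have "complex_of_real (\<Sum>x\<in>D. w x * (cmod (ctrace (cadj Y ** rep x))) ^ 4)
      = (\<Sum>x\<in>D. of_real (w x) * (\<Sum>p\<in>UNIV. \<Sum>q\<in>UNIV. \<Sum>r\<in>UNIV. \<Sum>s\<in>UNIV. c p q r s * T (rep x) p q r s))"
    unfolding of_real_sum of_real_mult expand ..
  also have "\<dots> = (\<Sum>x\<in>D. \<Sum>p\<in>UNIV. \<Sum>q\<in>UNIV. \<Sum>r\<in>UNIV. \<Sum>s\<in>UNIV. c p q r s * (of_real (w x) * T (rep x) p q r s))"
    unfolding sum_distrib_left by (intro sum.cong refl) (simp only: mult_ac)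
  also have "\<dots> = (\<Sum>p\<in>UNIV. \<Sum>q\<in>UNIV. \<Sum>r\<in>UNIV. \<Sum>s\<in>UNIV. \<Sum>x\<in>D. c p q r s * (of_real (w x) * T (rep x) p q r s))"
    by (subst sum.swap, rule sum.cong[OF refl], subst sum.swap, rule sum.cong[OF refl],
        subst sum.swap, rule sum.cong[OF refl], rule sum.swap)
  also have "\<dots> = (\<Sum>p\<in>UNIV. \<Sum>q\<in>UNIV. \<Sum>r\<in>UNIV. \<Sum>s\<in>UNIV. \<integral>U. c p q r s * T U p q r s \<partial>\<mu>)"
    by (simp add: sum_distrib_left[symmetric] T)
  also have "\<dots> = (\<integral>U. (\<Sum>p\<in>UNIV. \<Sum>q\<in>UNIV. \<Sum>r\<in>UNIV. \<Sum>s\<in>UNIV. c p q r s * T U p q r s) \<partial>\<mu>)"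
    by (simp only: haar_integral_sum[OF \<mu>] cont continuous_on_sum continuous_on_mult continuous_on_const)
  also have "\<dots> = 2"
    by (rule haar_trace_fourth_power[OF \<mu> n Y, unfolded expand])
  also have "2 = complex_of_real 2" by simp
  finally show ?thesis by (simp only: of_real_eq_iff)
qed

subsection \<open>Unitary operator bases\<close>

text \<open>The chosen representative differs from \<open>U\<close> by a unit phase, which the
  modulus discards.\<close>

lemma cmod_ctrace_rep_pclass:
  "cmod (ctrace (cadj Y ** rep (pclass U))) = cmod (ctrace (cadj Y ** U))"
proof -
  have "U \<in> pclass U" unfolding pclass_def
    by (rule CollectI, rule exI[of _ 1]) simp
  then have "rep (pclass U) \<in> pclass U" unfolding rep_def by (rule someI)
  then obtain c where c: "cmod c = 1" "rep (pclass U) = (\<chi> i j. c * U $ i $ j)"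
    unfolding pclass_def by blast
  have "ctrace (cadj Y ** rep (pclass U)) = c * ctrace (cadj Y ** U)"
    by (simp add: c(2) ctrace_cadj_mul sum_distrib_left mult_ac)
  then show ?thesis by (simp add: norm_mult c(1))
qed

text \<open>Equal classes would force the moduli \<open>CARD('n)\<close> and 0 to agree. Injectivity
  turns sums over the classes of a basis into sums over its indices.\<close>

lemma pclass_basis_inj:
  fixes U :: "nat \<Rightarrow> 'n::finite cmat"
  assumes "unitary_operator_basis U"
  shows "inj_on (\<lambda>j. pclass (U j)) {..<CARD('n)^2}"
proof (rule inj_onI, rule ccontr)
  fix j k assume j: "j \<in> {..<CARD('n)^2}" and k: "k \<in> {..<CARD('n)^2}"
    and eq: "pclass (U j) = pclass (U k)" and "j \<noteq> k"
  have "cmod (ctrace (cadj (U j) ** U j)) = cmod (ctrace (cadj (U j) ** U k))"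
    using cmod_ctrace_rep_pclass eq by metis
  moreover have "ctrace (cadj (U j) ** U j) = of_nat CARD('n)" "ctrace (cadj (U j) ** U k) = 0"
    using assms j k \<open>j \<noteq> k\<close> by (auto simp: unitary_operator_basis_def)
  ultimately show False by simp
qed

text \<open>Orthogonality says that a square matrix has a left inverse; completeness is the same
  inverse read from the right. The bijection \<open>h\<close> gives basis elements and matrix
  entries the same index type.\<close>

lemma basis_completeness:
  fixes U :: "nat \<Rightarrow> 'n::finite cmat"
  assumes U: "unitary_operator_basis U"
  shows "(\<Sum>j<CARD('n)^2. U j $ fst p $ snd p * cnj (U j $ fst q $ snd q))
    = (if p = q then of_nat CARD('n) else 0)"
proof -
  have card: "card (UNIV :: ('n \<times> 'n) set) = CARD('n)^2"
    by (simp add: power2_eq_square)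
  obtain h :: "'n \<times> 'n \<Rightarrow> nat" where h: "bij_betw h UNIV {..<CARD('n)^2}"
    using ex_bij_betw_finite_nat[of "UNIV :: ('n \<times> 'n) set"] unfolding card atLeast0LessThan by auto
  have h1: "h r < CARD('n)^2" for r using bij_betwE[OF h] by (metis UNIV_I lessThan_iff)
  have h2: "h r = h s \<longleftrightarrow> r = s" for r s using h by (simp add: bij_betw_def inj_eq)
  define A :: "complex ^ ('n \<times> 'n) ^ ('n \<times> 'n)"
    where "A = (\<chi> r p. cnj (U (h r) $ fst p $ snd p) / of_nat CARD('n))"
  define B :: "complex ^ ('n \<times> 'n) ^ ('n \<times> 'n)"
    where "B = (\<chi> p r. U (h r) $ fst p $ snd p)"
  have "(A ** B) $ r $ s = (if r = s then 1 else 0)" for r s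
  proof -
    have "(A ** B) $ r $ s = ctrace (cadj (U (h r)) ** U (h s)) / of_nat CARD('n)"
      unfolding ctrace_cadj_mul by (simp add: A_def B_def matrix_matrix_mult_def sum_divide_distrib)
    also have "\<dots> = (if r = s then 1 else 0)"
      using U h1[of r] h1[of s] h2[of r s] by (simp add: unitary_operator_basis_def)
    finally show ?thesis .
  qed
  then have "A ** B = mat 1" by (simp add: vec_eq_iff mat_def)
  then have "B ** A = mat 1" by (simp only: matrix_left_right_inverse)
  then have "(B ** A) $ p $ q = (if p = q then 1 else 0)" by (simp add: mat_def)
  moreover have "(B ** A) $ p $ q
      = (\<Sum>r\<in>UNIV. U (h r) $ fst p $ snd p * cnj (U (h r) $ fst q $ snd q)) / of_nat CARD('n)"
    by (simp add: A_def B_def matrix_matrix_mult_def sum_divide_distrib)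
  moreover have "(\<Sum>r\<in>UNIV. U (h r) $ fst p $ snd p * cnj (U (h r) $ fst q $ snd q))
      = (\<Sum>j<CARD('n)^2. U j $ fst p $ snd p * cnj (U j $ fst q $ snd q))"
    by (rule sum.reindex_bij_betw[OF h])
  ultimately show ?thesis by (simp add: divide_eq_eq split: if_splits)
qed

text \<open>Completeness collapses the double sum over entries to
  \<open>ctrace (cadj Y ** Y)\<close> times the dimension.\<close>

lemma basis_parseval:
  fixes U :: "nat \<Rightarrow> 'n::finite cmat"
  assumes U: "unitary_operator_basis U" and Y: "unitary Y"
  shows "(\<Sum>j<CARD('n)^2. (cmod (ctrace (cadj Y ** U j)))\<^sup>2) = real (CARD('n)^2)"
proof -
  let ?N = "of_nat CARD('n) :: complex"
  have "complex_of_real (\<Sum>j<CARD('n)^2. (cmod (ctrace (cadj Y ** U j)))\<^sup>2)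
    = (\<Sum>j<CARD('n)^2. ctrace (cadj Y ** U j) * cnj (ctrace (cadj Y ** U j)))"
    unfolding of_real_sum complex_norm_square ..
  also have "\<dots> = (\<Sum>j<CARD('n)^2. \<Sum>p\<in>UNIV. \<Sum>q\<in>UNIV. cnj (Y $ fst p $ snd p) * Y $ fst q $ snd q *
      (U j $ fst p $ snd p * cnj (U j $ fst q $ snd q)))"
    unfolding ctrace_cadj_mul cnj_sum sum_product
    by (intro sum.cong refl) simp
  also have "\<dots> = (\<Sum>p\<in>UNIV. \<Sum>q\<in>UNIV. \<Sum>j<CARD('n)^2. cnj (Y $ fst p $ snd p) * Y $ fst q $ snd q *
      (U j $ fst p $ snd p * cnj (U j $ fst q $ snd q)))"
    by (subst sum.swap, rule sum.cong[OF refl], rule sum.swap)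
  also have "\<dots> = (\<Sum>p\<in>UNIV. cnj (Y $ fst p $ snd p) * Y $ fst p $ snd p * ?N)"
    unfolding sum_distrib_left[symmetric] basis_completeness[OF U]
    by (simp add: if_distrib cong: if_cong)
  also have "\<dots> = ctrace (cadj Y ** Y) * ?N"
    unfolding ctrace_cadj_mul sum_distrib_right ..
  also have "\<dots> = ?N * ?N" using Y by (simp add: unitary_def ctrace_def mat_def)
  also have "\<dots> = complex_of_real (real (CARD('n)^2))" by (simp add: power2_eq_square)
  finally show ?thesis by (simp only: of_real_eq_iff)
qed

text \<open>A point lying in several of the sets carries the sum of their weights, so overlaps are
  counted consistently on both sides.\<close>

lemma sum_union_indicator:
  fixes wb :: "nat \<Rightarrow> real" and B :: "nat \<Rightarrow> 'a set"
  assumes fin: "\<And>a. a < m \<Longrightarrow> finite (B a)"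
  shows "(\<Sum>x\<in>(\<Union>a<m. B a). (\<Sum>a<m. wb a * indicator (B a) x) * F x) = (\<Sum>a<m. wb a * (\<Sum>x\<in>B a. F x))"
proof -
  let ?D = "\<Union>a<m. B a"
  have finD: "finite ?D" using fin by auto
  have "(\<Sum>x\<in>?D. (\<Sum>a<m. wb a * indicator (B a) x) * F x)
      = (\<Sum>a<m. \<Sum>x\<in>?D. wb a * (indicator (B a) x * F x))"
    unfolding sum_distrib_right by (subst sum.swap) (simp only: mult.assoc)
  also have "\<dots> = (\<Sum>a<m. wb a * (\<Sum>x\<in>B a. F x))"
  proof (rule sum.cong[OF refl])
    fix a assume "a \<in> {..<m}"
    then have "(\<Sum>x\<in>?D. indicator (B a) x * F x) = (\<Sum>x\<in>B a. F x)"
      using finD by (intro sum.mono_neutral_cong_right) (auto simp: indicator_def)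
    then show "(\<Sum>x\<in>?D. wb a * (indicator (B a) x * F x)) = wb a * (\<Sum>x\<in>B a. F x)"
      by (simp only: sum_distrib_left[symmetric])
  qed
  finally show ?thesis .
qed

theorem theorem5:
  fixes e :: "nat \<Rightarrow> nat \<Rightarrow> 'n::finite cmat"
    and wb :: "nat \<Rightarrow> real"
    and m :: nat
  assumes "CARD('n) > 1"
    and "\<forall>a < m. unitary_operator_basis (e a)"
    and "\<forall>a < m. wb a > 0"
    and "weighted_2_design (\<Union>a<m. pclass ` (e a) ` {..<CARD('n)^2})
           (\<lambda>x. \<Sum>a<m. wb a * indicator (pclass ` (e a) ` {..<CARD('n)^2}) x)"
  shows "m \<ge> CARD('n)^2 - 1 \<and>
         (m = CARD('n)^2 - 1 \<longrightarrow>
            (\<forall>a < m. wb a = 1 / (real m * real (CARD('n))^2)) \<and>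
            (\<forall>a < m. \<forall>b < m. a \<noteq> b \<longrightarrow> mutually_unbiased (e a) (e b)))"
proof -
  let ?n = "CARD('n)^2"
  define N where "N = real ?n"
  have n1: "?n > 1" by (rule one_less_power[OF assms(1)]) simp
  then have N1: "N > 1" unfolding N_def by linarith
  have basis: "unitary_operator_basis (e a)" if "a < m" for a using assms(2) that by blast
  have unit: "unitary (e a k)" if "a < m" "k < ?n" for a k
    using basis[OF that(1)] that(2) by (simp add: unitary_operator_basis_def)
  define B where "B a = pclass ` (e a) ` {..<?n}" for a
  have design: "weighted_2_design (\<Union>a<m. B a) (\<lambda>x. \<Sum>a<m. wb a * indicator (B a) x)"
    using assms(4) unfolding B_def .
  have sumD: "(\<Sum>x\<in>(\<Union>a<m. B a). (\<Sum>a<m. wb a * indicator (B a) x) * F x)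
      = (\<Sum>a<m. wb a * (\<Sum>j<?n. F (pclass (e a j))))" for F
  proof -
    have "(\<Sum>x\<in>B a. F x) = (\<Sum>j<?n. F (pclass (e a j)))" if "a < m" for a
      unfolding B_def image_image
      by (subst sum.reindex[OF pclass_basis_inj[OF basis[OF that]]]) (simp add: o_def)
    then show ?thesis by (subst sum_union_indicator) (auto simp: B_def)
  qed
  \<comment> \<open>Normalisation of the design, read through \<open>sumD\<close> with the constant
    function 1.\<close>
  have total: "(\<Sum>a<m. wb a) * N = 1"
  proof -
    have "(\<Sum>x\<in>(\<Union>a<m. B a). (\<Sum>a<m. wb a * indicator (B a) x) * 1) = 1"
      using design unfolding weighted_2_design_def by simp
    then show ?thesis unfolding sumD by (simp add: N_def sum_distrib_right)
  qed
  define t where "t b k a j = (cmod (ctrace (cadj (e b k) ** e a j)))\<^sup>2" for b k a j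
  \<comment> \<open>The squared deviation from unbiasedness. As the values \<open>t\<close> have
    mean 1, it is exactly the excess of their sum of squares over \<open>N\<close>.\<close>
  define S where "S b k a = (\<Sum>j<?n. (t b k a j - 1)\<^sup>2)" for b k a
  have S0: "S b k a \<ge> 0" for b k a by (simp add: S_def sum_nonneg)
  have fourth: "(\<Sum>a<m. wb a * (\<Sum>j<?n. (t b k a j)\<^sup>2)) = 2" if "b < m" "k < ?n" for b k
  proof -
    have "(cmod z) ^ 4 = ((cmod z)\<^sup>2)\<^sup>2" for z by simp
    then show ?thesis
      using design_trace_fourth_power[OF design assms(1) unit[OF that]] unfolding sumD
      by (simp add: cmod_ctrace_rep_pclass t_def)
  qed
  have tsum: "(\<Sum>j<?n. (t b k a j)\<^sup>2) = N + S b k a" if "a < m" "b < m" "k < ?n" for a b k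
  proof -
    have "(\<Sum>j<?n. t b k a j) = N"
      unfolding t_def N_def using that by (intro basis_parseval basis unit)
    moreover have "S b k a = (\<Sum>j<?n. (t b k a j)\<^sup>2) - 2 * (\<Sum>j<?n. t b k a j) + N"
      by (simp add: S_def N_def power2_diff sum.distrib sum_subtractf sum_distrib_left)
    ultimately show ?thesis by simp
  qed
  have tself: "(\<Sum>j<?n. (t b k b j)\<^sup>2) = N\<^sup>2" if "b < m" "k < ?n" for b k
  proof -
    have "t b k b j = (if j = k then N else 0)" if "j < ?n" for j
      using basis[OF \<open>b < m\<close>] \<open>k < ?n\<close> that
      by (auto simp: t_def N_def unitary_operator_basis_def)
    then have "(\<Sum>j<?n. (t b k b j)\<^sup>2) = (\<Sum>j<?n. if j = k then N\<^sup>2 else 0)"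
      by (intro sum.cong refl) simp
    then show ?thesis using that by simp
  qed
  \<comment> \<open>The design sum 2 splits into \<open>wb b * N\<^sup>2\<close> from the basis
    itself and \<open>wb a * (N + S b k a)\<close> from each other basis; \<open>total\<close>
    evaluates the sum of the remaining weights.\<close>
  have key: "wb b * (N * (N - 1)) = 1 - (\<Sum>a\<in>{..<m} - {b}. wb a * S b k a)" if "b < m" "k < ?n" for b k
  proof -
    have b: "b \<in> {..<m}" using that by simp
    have "2 = wb b * N\<^sup>2 + (\<Sum>a\<in>{..<m} - {b}. wb a * (\<Sum>j<?n. (t b k a j)\<^sup>2))"
      using fourth[OF that] tself[OF that] by (simp add: sum.remove[OF _ b])
    also have "(\<Sum>a\<in>{..<m} - {b}. wb a * (\<Sum>j<?n. (t b k a j)\<^sup>2))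
        = (\<Sum>a\<in>{..<m} - {b}. wb a * N + wb a * S b k a)"
      by (rule sum.cong) (use that tsum in \<open>auto simp: distrib_left\<close>)
    also have "\<dots> = (\<Sum>a\<in>{..<m} - {b}. wb a) * N + (\<Sum>a\<in>{..<m} - {b}. wb a * S b k a)"
      by (simp add: sum.distrib sum_distrib_right)
    also have "(\<Sum>a\<in>{..<m} - {b}. wb a) * N = 1 - wb b * N"
      using total by (simp add: sum.remove[OF _ b] algebra_simps)
    finally show ?thesis by (simp add: algebra_simps power2_eq_square)
  qed
  have rest0: "(\<Sum>a\<in>{..<m} - {b}. wb a * S b k a) \<ge> 0" for b k
    using assms(3) S0 by (intro sum_nonneg mult_nonneg_nonneg) (auto intro: less_imp_le)
  \<comment> \<open>Index 0 serves as a sample basis element, available since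
    \<open>?n > 1\<close>.\<close>
  have le1: "wb b * (N * (N - 1)) \<le> 1" if "b < m" for b
    using key[OF that, of 0] rest0[of b 0] n1 by simp
  have sum1: "(\<Sum>b<m. wb b * (N * (N - 1))) = N - 1"
    using total by (simp add: sum_distrib_right[symmetric] mult.assoc[symmetric])
  have "N - 1 \<le> real m"
    using sum_mono[of "{..<m}" "\<lambda>b. wb b * (N * (N - 1))" "\<lambda>_. 1"] le1 unfolding sum1 by simp
  then have m_ge: "m \<ge> ?n - 1" unfolding N_def by linarith
  have eq: "wb b * (N * (N - 1)) = 1" if m: "m = ?n - 1" and "b < m" for b
  proof -
    \<comment> \<open>The \<open>m\<close> terms are at most 1 and add up to
      \<open>N - 1 = m\<close>, so none can fall short.\<close>
    have "(\<Sum>b<m. 1 - wb b * (N * (N - 1))) = 0"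
      unfolding sum_subtractf sum1 using m n1 by (simp add: N_def)
    then have "\<forall>b\<in>{..<m}. 1 - wb b * (N * (N - 1)) = 0"
      by (subst (asm) sum_nonneg_eq_0_iff) (use le1 in auto)
    then show ?thesis using \<open>b < m\<close> by simp
  qed
  show ?thesis
  proof (intro conjI impI allI)
    show "m \<ge> ?n - 1" by (rule m_ge)
  next
    fix a assume m: "m = ?n - 1" and a: "a < m"
    have "real m * real (CARD('n))^2 = N * (N - 1)"
      using m n1 by (simp add: N_def of_nat_diff)
    then show "wb a = 1 / (real m * real (CARD('n))^2)"
      using eq[OF m a] N1 by (simp add: eq_divide_eq)
  next
    fix a b assume m: "m = ?n - 1" and a: "a < m" and b: "b < m" and ab: "a \<noteq> b"
    show "mutually_unbiased (e a) (e b)"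
      unfolding mutually_unbiased_def
    proof (intro allI impI)
      fix j k assume j: "j < ?n" and k: "k < ?n"
      \<comment> \<open>Equality in the weight bound leaves no room for deviation: a sum of
        nonnegative terms vanishes, and positive weights force each \<open>S\<close> to
        vanish.\<close>
      have "(\<Sum>c\<in>{..<m} - {a}. wb c * S a j c) = 0" using key[OF a j] eq[OF m a] by simp
      then have "\<forall>c\<in>{..<m} - {a}. wb c * S a j c = 0"
        by (subst (asm) sum_nonneg_eq_0_iff) (use assms(3) S0 in \<open>auto intro!: mult_nonneg_nonneg intro: less_imp_le\<close>)
      then have "wb b * S a j b = 0" using b ab by blast
      then have "S a j b = 0" using assms(3) b by fastforce
      then have "\<forall>k\<in>{..<?n}. (t a j b k - 1)\<^sup>2 = 0"
        unfolding S_def by (subst (asm) sum_nonneg_eq_0_iff) auto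
      then show "(cmod (ctrace (cadj (e a j) ** e b k)))\<^sup>2 = 1" using k by (simp add: t_def)
    qed
  qed
qed

end
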